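(* Let $G$ be a finitely generated nilpotent group, and let $\mu$ be an adapted and smooth probability measure on $G$ with centered Abelian drift $\mathbf m_{\mathrm{ab}}(\mu):=\sum_g\mu(g)[g]=0$ in $G_{\mathrm{ab}}\otimes_{\mathbb Z}\mathbb R$. Let $E$ be a complex Banach space. Then every Lipschitz $\mu$-harmonic map $f:G\to E$ has the form $$f(x)=c+\Lambda([x])\qquad(x\in G)$$ for some $c\in E$ and some (bounded) real-linear operator $\Lambda:G_{\mathrm{ab}}\otimes_{\mathbb Z}\mathbb R\to E$. If $\mu$ is adapted and smooth but not centered, the same holds with the constraint $\Lambda(\mathbf m_{\mathrm{ab}}(\mu))=0$.
   Context: Fix a finite symmetric generating set $S$ of $G$ with word length $|x|$. $G_{\mathrm{ab}}=G/[G,G]$; $[x]$ is the image of $x$ in $G_{\mathrm{ab}}\otimes_{\mathbb Z}\mathbb R$. $\mu$ is adapted if the semigroup generated by $\mathrm{supp}(\mu)$ is $G$; smooth if $\sum_x\mu(x)e^{\zeta|x|}<\infty$ for some $\zeta>0$. A map $f:G\to E$ is Lipschitz if $\sup_{s\in S,x\in G}\|f(xs)-f(x)\|<\infty$ and $\mu$-harmonic if $f(k)=\sum_g\mu(g)f(kg)$ (absolutely convergent in $E$) for all $k\in G$. *)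

theory Defs
  imports
    "HOL-Probability.Probability"
    "HOL-Algebra.Generated_Groups"
    "HOL-Algebra.Free_Abelian_Groups"
    "HOL-Algebra.Module"
begin

section \<open>Complex Banach spaces\<close>

class complex_banach = banach +
  fixes scaleC :: "complex \<Rightarrow> 'a \<Rightarrow> 'a"
  assumes scaleC_add_right: "scaleC a (x + y) = scaleC a x + scaleC a y"
    and scaleC_add_left: "scaleC (a + b) x = scaleC a x + scaleC b x"
    and scaleC_scaleC: "scaleC a (scaleC b x) = scaleC (a * b) x"
    and scaleC_of_real: "scaleC (complex_of_real r) x = r *\<^sub>R x"
    and norm_scaleC: "norm (scaleC a x) = cmod a * norm x"

instantiation complex :: complex_banach
begin

definition scaleC_complex :: "complex \<Rightarrow> complex \<Rightarrow> complex" where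
  "scaleC_complex a x = a * x"

instance
  by standard
    (simp_all add: scaleC_complex_def algebra_simps norm_mult scaleR_conv_of_real)

end


section \<open>Groups\<close>

primrec lower_central_series :: "('g, 'b) monoid_scheme \<Rightarrow> nat \<Rightarrow> 'g set" where
  "lower_central_series G 0 = carrier G"
| "lower_central_series G (Suc n) =
     generate G (\<Union>h \<in> lower_central_series G n. \<Union>g \<in> carrier G.
       {h \<otimes>\<^bsub>G\<^esub> g \<otimes>\<^bsub>G\<^esub> inv\<^bsub>G\<^esub> h \<otimes>\<^bsub>G\<^esub> inv\<^bsub>G\<^esub> g})"

definition nilpotent_group :: "('g, 'b) monoid_scheme \<Rightarrow> bool" where
  "nilpotent_group G \<longleftrightarrow> group G \<and> (\<exists>n. lower_central_series G n = {\<one>\<^bsub>G\<^esub>})"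

definition symmetric_generating_set :: "('g, 'b) monoid_scheme \<Rightarrow> 'g set \<Rightarrow> bool" where
  "symmetric_generating_set G S \<longleftrightarrow>
     S \<subseteq> carrier G \<and> (\<forall>s\<in>S. inv\<^bsub>G\<^esub> s \<in> S) \<and> generate G S = carrier G"

definition word_length :: "('g, 'b) monoid_scheme \<Rightarrow> 'g set \<Rightarrow> 'g \<Rightarrow> nat" where
  "word_length G S x =
     (LEAST n. \<exists>w. length w = n \<and> set w \<subseteq> S \<and> foldr (mult G) w \<one>\<^bsub>G\<^esub> = x)"

inductive_set generated_semigroup :: "('g, 'b) monoid_scheme \<Rightarrow> 'g set \<Rightarrow> 'g set"
  for G (structure) and A where
  incl: "a \<in> A \<Longrightarrow> a \<in> generated_semigroup G A"
| mult: "x \<in> generated_semigroup G A \<Longrightarrow> y \<in> generated_semigroup G A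
         \<Longrightarrow> x \<otimes> y \<in> generated_semigroup G A"

definition abelianization :: "('g, 'b) monoid_scheme \<Rightarrow> 'g set monoid" where
  "abelianization G = G Mod derived G (carrier G)"


section \<open>Extension of scalars of an abelian group to the reals\<close>

text \<open>
  For a multiplicatively written abelian group \<open>A\<close>, the tensor product of \<open>A\<close> and the reals over
  the integers is the free abelian group on \<open>carrier A \<times> UNIV\<close> modulo the subgroup generated by the
  bilinearity relations (compatibility with the action of the integers follows from
  biadditivity). It is a real vector space with \<open>r (a \<otimes> t) = a \<otimes> (r t)\<close>.
\<close>

definition tensor_real_relations ::
    "('a, 'b) monoid_scheme \<Rightarrow> ('a \<times> real \<Rightarrow>\<^sub>0 int) set" where
  "tensor_real_relations A = generate (free_Abelian_group (carrier A \<times> UNIV))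
     ({frag_of (a \<otimes>\<^bsub>A\<^esub> b, t) - frag_of (a, t) - frag_of (b, t) | a b t.
         a \<in> carrier A \<and> b \<in> carrier A} \<union>
      {frag_of (a, s + t) - frag_of (a, s) - frag_of (a, t) | a s t. a \<in> carrier A})"

definition tensor_real_class ::
    "('a, 'b) monoid_scheme \<Rightarrow> ('a \<times> real \<Rightarrow>\<^sub>0 int) \<Rightarrow> ('a \<times> real \<Rightarrow>\<^sub>0 int) set" where
  "tensor_real_class A c =
     tensor_real_relations A #>\<^bsub>free_Abelian_group (carrier A \<times> UNIV)\<^esub> c"

text \<open>
  The fields \<open>mult\<close> and \<open>one\<close> of a module record play no role.
\<close>

definition tensor_real ::
    "('a, 'b) monoid_scheme \<Rightarrow> (real, ('a \<times> real \<Rightarrow>\<^sub>0 int) set) module" where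
  "tensor_real A =
     (let Q = free_Abelian_group (carrier A \<times> UNIV) Mod tensor_real_relations A in
      \<lparr>carrier = carrier Q,
       mult = undefined,
       one = undefined,
       zero = one Q,
       add = mult Q,
       smult = (\<lambda>r X. \<Union>c\<in>X. tensor_real_class A (frag_extend (\<lambda>(a, t). frag_of (a, r * t)) c))\<rparr>)"

definition pure_tensor ::
    "('a, 'b) monoid_scheme \<Rightarrow> 'a \<Rightarrow> real \<Rightarrow> ('a \<times> real \<Rightarrow>\<^sub>0 int) set" where
  "pure_tensor A a t = tensor_real_class A (frag_of (a, t))"

definition real_linear_on ::
    "(real, 'v, 'm) module_scheme \<Rightarrow> ('v \<Rightarrow> 'e::real_vector) \<Rightarrow> bool" where
  "real_linear_on V L \<longleftrightarrow>
     (\<forall>u\<in>carrier V. \<forall>v\<in>carrier V. L (u \<oplus>\<^bsub>V\<^esub> v) = L u + L v) \<and>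
     (\<forall>r. \<forall>v\<in>carrier V. L (r \<odot>\<^bsub>V\<^esub> v) = r *\<^sub>R L v)"

text \<open>
  The coarsest topology for which all real-linear functionals are continuous. For a
  finite-dimensional \<open>V\<close>, in particular for the tensor product of the reals with a finitely
  generated abelian group, this is the usual (norm) topology.
\<close>

definition linear_topology :: "(real, 'v, 'm) module_scheme \<Rightarrow> 'v topology" where
  "linear_topology V = topology_generated_by
     {{v \<in> carrier V. \<phi> v \<in> U} | (\<phi> :: 'v \<Rightarrow> real) U. real_linear_on V \<phi> \<and> open U}"

abbreviation real_abelianization ::
    "('g, 'b) monoid_scheme \<Rightarrow> (real, ('g set \<times> real \<Rightarrow>\<^sub>0 int) set) module" where
  "real_abelianization G \<equiv> tensor_real (abelianization G)"

definition ab_image ::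
    "('g, 'b) monoid_scheme \<Rightarrow> 'g \<Rightarrow> ('g set \<times> real \<Rightarrow>\<^sub>0 int) set" where
  "ab_image G x = pure_tensor (abelianization G) (derived G (carrier G) #>\<^bsub>G\<^esub> x) 1"


section \<open>Measures and harmonic maps\<close>

definition adapted :: "('g, 'b) monoid_scheme \<Rightarrow> 'g pmf \<Rightarrow> bool" where
  "adapted G \<mu> \<longleftrightarrow> generated_semigroup G (set_pmf \<mu>) = carrier G"

definition smooth_measure ::
    "('g, 'b) monoid_scheme \<Rightarrow> 'g set \<Rightarrow> 'g pmf \<Rightarrow> bool" where
  "smooth_measure G S \<mu> \<longleftrightarrow>
     (\<exists>\<zeta>>0. (\<lambda>x. pmf \<mu> x * exp (\<zeta> * real (word_length G S x))) summable_on carrier G)"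

text \<open>
  The limit below exists and is unique when \<open>G\<close> is finitely generated and \<open>\<mu>\<close> has a finite first
  moment, in particular when \<open>\<mu>\<close> is smooth; it is taken over the net of finite subsets of \<open>G\<close>.
\<close>

definition ab_drift ::
    "('g, 'b) monoid_scheme \<Rightarrow> 'g pmf \<Rightarrow> ('g set \<times> real \<Rightarrow>\<^sub>0 int) set" where
  "ab_drift G \<mu> = (THE m. limitin (linear_topology (real_abelianization G))
     (\<lambda>F. finsum (real_abelianization G)
        (\<lambda>g. pmf \<mu> g \<odot>\<^bsub>real_abelianization G\<^esub> ab_image G g) F)
     m (finite_subsets_at_top (carrier G)))"

definition lipschitz_map ::
    "('g, 'b) monoid_scheme \<Rightarrow> 'g set \<Rightarrow> ('g \<Rightarrow> 'e::real_normed_vector) \<Rightarrow> bool" where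
  "lipschitz_map G S f \<longleftrightarrow>
     bdd_above {norm (f (x \<otimes>\<^bsub>G\<^esub> s) - f x) | x s. x \<in> carrier G \<and> s \<in> S}"

definition harmonic_map ::
    "('g, 'b) monoid_scheme \<Rightarrow> 'g pmf \<Rightarrow> ('g \<Rightarrow> 'e::banach) \<Rightarrow> bool" where
  "harmonic_map G \<mu> f \<longleftrightarrow> (\<forall>k\<in>carrier G.
     (\<lambda>g. pmf \<mu> g *\<^sub>R f (k \<otimes>\<^bsub>G\<^esub> g)) abs_summable_on carrier G \<and>
     f k = (\<Sum>\<^sub>\<infinity>g\<in>carrier G. pmf \<mu> g *\<^sub>R f (k \<otimes>\<^bsub>G\<^esub> g)))"

text \<open>
  On a finite-dimensional \<open>V\<close>, continuity for \<open>linear_topology V\<close> is boundedness with respect to any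
  norm on \<open>V\<close>.
\<close>

definition bounded_real_linear_on ::
    "(real, 'v, 'm) module_scheme \<Rightarrow> ('v \<Rightarrow> 'e::real_normed_vector) \<Rightarrow> bool" where
  "bounded_real_linear_on V L \<longleftrightarrow>
     real_linear_on V L \<and> continuous_map (linear_topology V) euclidean L"

end

theory Submission
  imports Defs
begin

text \<open>
  Let \<open>z\<close> lie in a term of the lower central series such that \<open>f\<close> is invariant under the next term.
  Then \<open>f (x z) = f (z x)\<close>, so \<open>x \<mapsto> f (x z) - f x\<close> is harmonic, and it is bounded because \<open>f\<close> is
  Lipschitz. By a Choquet--Deny argument it is a constant \<open>\<lambda> z\<close>, additive in \<open>z\<close>. If \<open>z = [a, b]\<close>,
  then exchanging the \<open>n\<close>-th powers of \<open>a\<close> and \<open>b\<close> changes \<open>f\<close> by \<open>n\<^sup>2 \<lambda> z\<close>, but by at most a constant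
  times \<open>n\<close>; hence \<open>\<lambda> z = 0\<close>, and \<open>f\<close> is invariant under the whole term. Descending to the
  commutator subgroup and applying the first step once more to the whole group, \<open>f - f 1\<close> is
  additive. It then factors through the abelianization, and harmonicity at \<open>1\<close> says that it
  vanishes on the drift.
\<close>

section \<open>Mean values along a measure\<close>

text \<open>The centering of \<mu> plays no part in the descent: it treats bounded differences of f,
  and bounded harmonic functions are constant whatever the drift. So one statement, with \<Lambda>
  vanishing at the drift, serves both cases of the theorem. The descent has to run upward from the
  trivial end of the series because harmonicity is inherited by left translates, while the
  differences of interest are right translates. The two agree for z only when f is already blind to
  commutators with z, that is, to the next term. The same centrality lets a commutator be carried
  out of the middle of a word. Two obstacles remain after additivity. The drift is the limit of an
  infinite series in a topology on a carrier set. Splitting each group element into generators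
  collapses the series to a finite combination of the classes of S, which gives existence;
  uniqueness needs enough real functionals on the tensor product. Boundedness of \<Lambda> into a
  possibly infinite-dimensional E holds because the values on S span its range.\<close>

lemma pmf_has_sum_1:
  assumes "set_pmf p \<subseteq> A"
  shows "(pmf p has_sum 1) A"
proof -
  have "infsum (pmf p) A = 1"
    using infsetsum_pmf_eq_1[OF assms] infsetsum_infsum[OF pmf_abs_summable] by metis
  moreover have "pmf p summable_on A"
    using pmf_abs_summable[of p A] by (simp flip: abs_summable_equivalent)
  ultimately show ?thesis
    by (simp add: has_sum_iff)
qed

text \<open>\<open>has_sum\<close> holds convergence and value together, so differences are handled
  by \<open>has_sum_add\<close>; the notion makes sense without completeness of the target.\<close>

definition mean_value :: "('g, 'b) monoid_scheme \<Rightarrow> 'g pmf \<Rightarrow> ('g \<Rightarrow> 'e::real_normed_vector) \<Rightarrow> bool" where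
  "mean_value G \<mu> v \<longleftrightarrow>
     (\<forall>x\<in>carrier G. ((\<lambda>g. pmf \<mu> g *\<^sub>R v (x \<otimes>\<^bsub>G\<^esub> g)) has_sum v x) (carrier G))"

lemma harmonic_map_mean_value:
  fixes f :: "'g \<Rightarrow> 'e::banach"
  assumes "harmonic_map G \<mu> f"
  shows "mean_value G \<mu> f"
  unfolding mean_value_def
proof
  fix x assume "x \<in> carrier G"
  then have "(\<lambda>g. pmf \<mu> g *\<^sub>R f (x \<otimes>\<^bsub>G\<^esub> g)) summable_on carrier G"
    and "f x = (\<Sum>\<^sub>\<infinity>g\<in>carrier G. pmf \<mu> g *\<^sub>R f (x \<otimes>\<^bsub>G\<^esub> g))"
    using assms unfolding harmonic_map_def by (blast intro: abs_summable_summable)+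
  then show "((\<lambda>g. pmf \<mu> g *\<^sub>R f (x \<otimes>\<^bsub>G\<^esub> g)) has_sum f x) (carrier G)"
    by (metis summable_iff_has_sum_infsum)
qed

context group
begin

lemma mult_inv_cancel:
  assumes "x \<in> carrier G" "y \<in> carrier G"
  shows "x \<otimes> (inv x \<otimes> y) = y" and "inv x \<otimes> (x \<otimes> y) = y"
  using assms by (simp_all flip: m_assoc)

lemma generated_semigroup_closed:
  assumes "A \<subseteq> carrier G" and "g \<in> generated_semigroup G A"
  shows "g \<in> carrier G"
  using assms(2) by induction (use assms(1) in auto)

lemma mean_value_cong:
  assumes "\<And>x. x \<in> carrier G \<Longrightarrow> v x = w x"
  shows "mean_value G \<mu> v \<longleftrightarrow> mean_value G \<mu> w"
  unfolding mean_value_def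
proof (intro ball_cong refl)
  fix x assume "x \<in> carrier G"
  then show "((\<lambda>g. pmf \<mu> g *\<^sub>R v (x \<otimes> g)) has_sum v x) (carrier G) \<longleftrightarrow>
      ((\<lambda>g. pmf \<mu> g *\<^sub>R w (x \<otimes> g)) has_sum w x) (carrier G)"
    unfolding assms[OF \<open>x \<in> carrier G\<close>] by (intro has_sum_cong) (simp add: assms)
qed

text \<open>The mean is taken over right multiplication by \<open>g\<close>, which commutes with
  left translation by \<open>z\<close>.\<close>

lemma mean_value_translate_diff:
  assumes v: "mean_value G \<mu> v" and z: "z \<in> carrier G"
  shows "mean_value G \<mu> (\<lambda>x. v (z \<otimes> x) - v x)"
  unfolding mean_value_def
proof
  fix x assume x: "x \<in> carrier G"
  have "((\<lambda>g. pmf \<mu> g *\<^sub>R v (z \<otimes> x \<otimes> g) - pmf \<mu> g *\<^sub>R v (x \<otimes> g)) has_sum v (z \<otimes> x) - v x) (carrier G)"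
  proof -
    have "((\<lambda>g. pmf \<mu> g *\<^sub>R v (z \<otimes> x \<otimes> g)) has_sum v (z \<otimes> x)) (carrier G)"
      and "((\<lambda>g. pmf \<mu> g *\<^sub>R v (x \<otimes> g)) has_sum v x) (carrier G)"
      using v x z unfolding mean_value_def by simp_all
    from has_sum_add[OF this(1) has_sum_scaleR[OF this(2), of "- 1"]] show ?thesis
      by simp
  qed
  then show "((\<lambda>g. pmf \<mu> g *\<^sub>R (v (z \<otimes> (x \<otimes> g)) - v (x \<otimes> g))) has_sum v (z \<otimes> x) - v x) (carrier G)"
    by (rule has_sum_cong[THEN iffD1, rotated]) (use x z in \<open>simp add: m_assoc scaleR_diff_right\<close>)
qed

text \<open>
  If a harmonic function bounded by \<open>B\<close> is written as \<open>v x = \<epsilon> v (x g) + remainder\<close>, the remainder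
  is a combination of values of \<open>v\<close> with total weight \<open>1 - \<epsilon>\<close>. The bound below expresses this
  without convolution powers of the measure.
\<close>

lemma mean_value_dominates:
  assumes mu: "set_pmf \<mu> \<subseteq> carrier G" and g: "g \<in> generated_semigroup G (set_pmf \<mu>)"
  shows "\<exists>\<epsilon>>0. \<forall>(v :: 'a \<Rightarrow> 'e::real_normed_vector) B.
           mean_value G \<mu> v \<longrightarrow> (\<forall>x\<in>carrier G. norm (v x) \<le> B) \<longrightarrow>
           (\<forall>x\<in>carrier G. norm (v x - \<epsilon> *\<^sub>R v (x \<otimes> g)) \<le> (1 - \<epsilon>) * B)"
  using g
proof induction
  case (incl a)
  then have a: "a \<in> carrier G" "pmf \<mu> a > 0"
    using mu by (auto simp: pmf_positive_iff)
  show ?case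
  proof (intro exI[of _ "pmf \<mu> a"] conjI a allI impI ballI)
    fix v :: "'a \<Rightarrow> 'e" and B x
    assume v: "mean_value G \<mu> v" "\<forall>x\<in>carrier G. norm (v x) \<le> B" and x: "x \<in> carrier G"
    \<comment> \<open>The atom at \<open>a\<close> is split off; the rest of the series has total
      weight \<open>1 - pmf \<mu> a\<close>.\<close>
    have 1: "((\<lambda>g. pmf \<mu> g *\<^sub>R v (x \<otimes> g)) has_sum v x - pmf \<mu> a *\<^sub>R v (x \<otimes> a)) (carrier G - {a})"
      using v(1) x a unfolding mean_value_def
      by (intro has_sum_Diff) (auto intro: has_sum_finiteI)
    have 2: "(pmf \<mu> has_sum 1 - pmf \<mu> a) (carrier G - {a})"
      using pmf_has_sum_1[OF mu] a
      by (intro has_sum_Diff) (auto intro: has_sum_finiteI)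
    show "norm (v x - pmf \<mu> a *\<^sub>R v (x \<otimes> a)) \<le> (1 - pmf \<mu> a) * B"
      by (rule norm_infsum_le[OF 1 has_sum_cmult_left[OF 2]])
        (use v(2) x in \<open>auto intro: mult_left_mono\<close>)
  qed
next
  case (mult g h)
  from mult.IH(1) obtain \<epsilon> where \<epsilon>_pos: "\<epsilon> > 0" and
    \<epsilon>: "\<forall>(v :: 'a \<Rightarrow> 'e) B. mean_value G \<mu> v \<longrightarrow> (\<forall>x\<in>carrier G. norm (v x) \<le> B) \<longrightarrow>
          (\<forall>x\<in>carrier G. norm (v x - \<epsilon> *\<^sub>R v (x \<otimes> g)) \<le> (1 - \<epsilon>) * B)"
    by (elim exE conjE)
  from mult.IH(2) obtain \<delta> where \<delta>_pos: "\<delta> > 0" and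
    \<delta>: "\<forall>(v :: 'a \<Rightarrow> 'e) B. mean_value G \<mu> v \<longrightarrow> (\<forall>x\<in>carrier G. norm (v x) \<le> B) \<longrightarrow>
          (\<forall>x\<in>carrier G. norm (v x - \<delta> *\<^sub>R v (x \<otimes> h)) \<le> (1 - \<delta>) * B)"
    by (elim exE conjE)
  note pos = \<epsilon>_pos \<delta>_pos
  have gh: "g \<in> carrier G" "h \<in> carrier G"
    using mult.hyps generated_semigroup_closed[OF mu] by auto
  show ?case
  proof (intro exI[of _ "\<epsilon> * \<delta>"] conjI allI impI ballI)
    fix v :: "'a \<Rightarrow> 'e" and B x
    assume v: "mean_value G \<mu> v" "\<forall>x\<in>carrier G. norm (v x) \<le> B" and x: "x \<in> carrier G"
    \<comment> \<open>The estimate for \<open>h\<close> is applied at the point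
      \<open>x \<otimes> g\<close>; the errors combine as \<open>(1 - \<epsilon>) + \<epsilon> * (1
      - \<delta>) = 1 - \<epsilon> * \<delta>\<close>.\<close>
    have "v x - (\<epsilon> * \<delta>) *\<^sub>R v (x \<otimes> (g \<otimes> h)) =
        (v x - \<epsilon> *\<^sub>R v (x \<otimes> g)) + \<epsilon> *\<^sub>R (v (x \<otimes> g) - \<delta> *\<^sub>R v (x \<otimes> g \<otimes> h))"
      using x gh by (simp add: m_assoc algebra_simps)
    also have "norm \<dots> \<le> norm (v x - \<epsilon> *\<^sub>R v (x \<otimes> g)) + \<epsilon> * norm (v (x \<otimes> g) - \<delta> *\<^sub>R v (x \<otimes> g \<otimes> h))"
      by (rule order_trans[OF norm_triangle_ineq]) (use pos in simp)
    also have "\<dots> \<le> (1 - \<epsilon>) * B + \<epsilon> * ((1 - \<delta>) * B)"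
      using \<epsilon>[rule_format, OF v(1) v(2)[rule_format] x]
        \<delta>[rule_format, OF v(1) v(2)[rule_format], of "x \<otimes> g"] x gh pos
      by (intro add_mono mult_left_mono) auto
    finally show "norm (v x - (\<epsilon> * \<delta>) *\<^sub>R v (x \<otimes> (g \<otimes> h))) \<le> (1 - \<epsilon> * \<delta>) * B"
      by (simp add: algebra_simps)
  qed (use pos in simp)
qed

text \<open>The surplus weight \<open>\<epsilon> - \<delta>\<close> moves into the remainder. This
  provides one common weight for finitely many translates.\<close>

lemma mean_value_dominates_le:
  fixes v :: "'a \<Rightarrow> 'e::real_normed_vector"
  assumes "norm (v x - \<epsilon> *\<^sub>R v y) \<le> (1 - \<epsilon>) * B" "\<delta> \<le> \<epsilon>" "norm (v y) \<le> B"
  shows "norm (v x - \<delta> *\<^sub>R v y) \<le> (1 - \<delta>) * B"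
proof -
  have "v x - \<delta> *\<^sub>R v y = (v x - \<epsilon> *\<^sub>R v y) + (\<epsilon> - \<delta>) *\<^sub>R v y"
    by (simp add: algebra_simps)
  also have "norm \<dots> \<le> norm (v x - \<epsilon> *\<^sub>R v y) + norm ((\<epsilon> - \<delta>) *\<^sub>R v y)"
    by (rule norm_triangle_ineq)
  also have "\<dots> \<le> (1 - \<epsilon>) * B + (\<epsilon> - \<delta>) * B"
    using assms by (intro add_mono) (auto intro: mult_left_mono)
  finally show ?thesis
    by (simp add: algebra_simps)
qed

text \<open>Let \<open>S\<close> be the supremum of the norms. Splitting \<open>v x\<close> with a
  common weight \<open>\<delta>\<close> along each \<open>g j\<close> and averaging over
  \<open>j\<close> gives \<open>S \<le> \<delta> * C + (1 - \<delta>) * S\<close>, hence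
  \<open>S \<le> C\<close>. The weight depends on \<open>N\<close> but cancels, so \<open>N\<close>
  may tend to infinity afterwards.\<close>

lemma mean_value_norm_le_average:
  fixes v :: "'a \<Rightarrow> 'e::real_normed_vector"
  assumes mu: "set_pmf \<mu> \<subseteq> carrier G" "adapted G \<mu>"
    and v: "mean_value G \<mu> v" "\<And>x. x \<in> carrier G \<Longrightarrow> norm (v x) \<le> B"
    and g: "\<And>j. j < N \<Longrightarrow> g j \<in> carrier G" and N: "N > 0"
    and av: "\<And>x. x \<in> carrier G \<Longrightarrow> norm (\<Sum>j<N. v (x \<otimes> g j)) \<le> real N * C"
    and x: "x \<in> carrier G"
  shows "norm (v x) \<le> C"
proof -
  have "\<exists>\<epsilon>>0. \<forall>(w :: 'a \<Rightarrow> 'e) B.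
           mean_value G \<mu> w \<longrightarrow> (\<forall>x\<in>carrier G. norm (w x) \<le> B) \<longrightarrow>
           (\<forall>x\<in>carrier G. norm (w x - \<epsilon> *\<^sub>R w (x \<otimes> g j)) \<le> (1 - \<epsilon>) * B)" if "j < N" for j
    using mean_value_dominates[OF mu(1)] mu(2) g[OF that] unfolding adapted_def by blast
  then obtain \<epsilon> where \<epsilon>: "\<And>j. j < N \<Longrightarrow> \<epsilon> j > 0"
    "\<And>j (w :: 'a \<Rightarrow> 'e) B x. j < N \<Longrightarrow> mean_value G \<mu> w \<Longrightarrow> \<forall>x\<in>carrier G. norm (w x) \<le> B \<Longrightarrow> x \<in> carrier G \<Longrightarrow>
        norm (w x - \<epsilon> j *\<^sub>R w (x \<otimes> g j)) \<le> (1 - \<epsilon> j) * B"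
    by metis
  define \<delta> where "\<delta> = Min (\<epsilon> ` {..<N})"
  have "finite (\<epsilon> ` {..<N})" "\<epsilon> ` {..<N} \<noteq> {}"
    using N by auto
  from Min_in[OF this] Min_le[OF this(1)] have \<delta>: "\<delta> > 0" "\<And>j. j < N \<Longrightarrow> \<delta> \<le> \<epsilon> j"
    unfolding \<delta>_def using \<epsilon>(1) by auto
  define S where "S = (SUP x\<in>carrier G. norm (v x))"
  have bdd: "bdd_above ((\<lambda>x. norm (v x)) ` carrier G)"
    using v(2) by (auto intro!: bdd_aboveI)
  have S: "norm (v x) \<le> S" if "x \<in> carrier G" for x
    unfolding S_def using bdd that by (rule cSUP_upper2) auto
  have "norm (v x) \<le> \<delta> * C + (1 - \<delta>) * S" if x: "x \<in> carrier G" for x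
  proof -
    have "real N * norm (v x) = norm (\<Sum>j<N. v x)"
      by (simp add: sum_constant_scaleR)
    also have "(\<Sum>j<N. v x) = (\<Sum>j<N. v x - \<delta> *\<^sub>R v (x \<otimes> g j)) + \<delta> *\<^sub>R (\<Sum>j<N. v (x \<otimes> g j))"
      by (simp add: sum_subtractf scaleR_sum_right del: sum_constant)
    also have "norm \<dots> \<le> (\<Sum>j<N. (1 - \<delta>) * S) + \<delta> * (real N * C)"
    proof (rule norm_triangle_mono)
      show "norm (\<Sum>j<N. v x - \<delta> *\<^sub>R v (x \<otimes> g j)) \<le> (\<Sum>j<N. (1 - \<delta>) * S)"
      proof (rule sum_norm_le)
        fix j assume "j \<in> {..<N}"
        then have j: "j < N" by simp
        have "norm (v x - \<epsilon> j *\<^sub>R v (x \<otimes> g j)) \<le> (1 - \<epsilon> j) * S"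
          using \<epsilon>(2)[OF j v(1) _ x] S by blast
        then show "norm (v x - \<delta> *\<^sub>R v (x \<otimes> g j)) \<le> (1 - \<delta>) * S"
          by (rule mean_value_dominates_le) (use \<delta>(2)[OF j] S x g[OF j] in auto)
      qed
    qed (use av[OF x] \<delta>(1) in \<open>auto intro: mult_left_mono\<close>)
    finally have "real N * norm (v x) \<le> real N * (\<delta> * C + (1 - \<delta>) * S)"
      by (simp add: algebra_simps)
    then show ?thesis
      using N by (simp add: mult_le_cancel_left_pos)
  qed
  then have "S \<le> \<delta> * C + (1 - \<delta>) * S"
    unfolding S_def by (intro cSUP_least) auto
  then have "\<delta> * S \<le> \<delta> * C"
    by (simp add: algebra_simps)
  then have "S \<le> C"
    using \<delta>(1) by simp
  then show ?thesis
    using S[OF x] by simp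
qed

section \<open>Descent along the lower central series\<close>

definition right_invariant :: "('a \<Rightarrow> 'e) \<Rightarrow> 'a set \<Rightarrow> bool" where
  "right_invariant f H \<longleftrightarrow> (\<forall>x\<in>carrier G. \<forall>h\<in>H. f (x \<otimes> h) = f x)"

lemma lower_central_series_subgroup: "subgroup (lower_central_series G n) G"
proof (induction n)
  case 0
  show ?case by (simp add: subgroup_self)
next
  case (Suc n)
  then interpret H: subgroup "lower_central_series G n" G .
  show ?case
    using H.subset by (auto intro!: generate_is_subgroup)
qed

lemma lower_central_series_in_carrier: "h \<in> lower_central_series G n \<Longrightarrow> h \<in> carrier G"
  using lower_central_series_subgroup subgroup.mem_carrier by metis

text \<open>The commutator of \<open>inv z\<close> and \<open>inv x\<close>, multiplied on the right
  of \<open>x \<otimes> z\<close>, yields \<open>z \<otimes> x\<close>. The prefix \<open>u\<close>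
  allows the exchange behind other factors.\<close>

lemma right_invariant_commute:
  assumes f: "right_invariant f (lower_central_series G (Suc n))"
    and z: "z \<in> lower_central_series G n" and x: "u \<in> carrier G" "x \<in> carrier G"
  shows "f (u \<otimes> z \<otimes> x) = f (u \<otimes> x \<otimes> z)"
proof -
  have zc: "z \<in> carrier G"
    using z by (rule lower_central_series_in_carrier)
  have "inv z \<in> lower_central_series G n"
    using lower_central_series_subgroup z by (rule subgroup.m_inv_closed)
  then have "inv z \<otimes> inv x \<otimes> z \<otimes> x \<in> lower_central_series G (Suc n)"
    unfolding lower_central_series.simps
    by (intro generate.incl UN_I[of "inv z"] UN_I[of "inv x"]) (use x zc in auto)
  then have "f (u \<otimes> x \<otimes> z \<otimes> (inv z \<otimes> inv x \<otimes> z \<otimes> x)) = f (u \<otimes> x \<otimes> z)"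
    using f x zc unfolding right_invariant_def by simp
  also have "u \<otimes> x \<otimes> z \<otimes> (inv z \<otimes> inv x \<otimes> z \<otimes> x) = u \<otimes> z \<otimes> x"
    using x zc by (simp add: m_assoc mult_inv_cancel)
  finally show ?thesis .
qed

text \<open>A right translate need not be harmonic; here it coincides with the left translate, which
  is.\<close>

lemma mean_value_right_diff:
  assumes f: "right_invariant f (lower_central_series G (Suc n))" "mean_value G \<mu> f"
    and z: "z \<in> lower_central_series G n"
  shows "mean_value G \<mu> (\<lambda>x. f (x \<otimes> z) - f x)"
proof -
  have z': "z \<in> carrier G"
    using z by (rule lower_central_series_in_carrier)
  have eq: "f (z \<otimes> x) - f x = f (x \<otimes> z) - f x" if "x \<in> carrier G" for x
    using right_invariant_commute[OF f(1) z, of \<one> x] that z' by simp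
  have "mean_value G \<mu> (\<lambda>x. f (z \<otimes> x) - f x)"
    using f(2) z' by (rule mean_value_translate_diff)
  then show ?thesis
    by (rule mean_value_cong[THEN iffD1, rotated]) (rule eq)
qed

text \<open>Induction from \<open>k\<close>, where invariance is trivial, down to \<open>m\<close>.
  Bounded harmonic functions take \<open>m = 0\<close>; the Lipschitz function stops at the
  commutator subgroup, \<open>m = 1\<close>.\<close>

lemma right_invariant_lower_central_seriesI:
  assumes "\<And>n. right_invariant f (lower_central_series G (Suc n)) \<Longrightarrow> n \<ge> m \<Longrightarrow>
             right_invariant f (lower_central_series G n)"
    and "lower_central_series G k = {\<one>}" "m \<le> k"
  shows "right_invariant f (lower_central_series G m)"
  using \<open>m \<le> k\<close>
proof (induction rule: inc_induct)
  case base
  show ?case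
    using assms(2) by (simp add: right_invariant_def)
qed (use assms(1) in blast)

text \<open>
  A Choquet--Deny theorem: modulo the next term of the series \<open>z\<close> is central, so
  \<open>h (x z) - h x\<close> is again harmonic, and its averages over the powers of \<open>z\<close> telescope.
\<close>

lemma bounded_mean_value_constant:
  fixes h :: "'a \<Rightarrow> 'e::real_normed_vector"
  assumes nil: "lower_central_series G k = {\<one>}"
    and mu: "set_pmf \<mu> \<subseteq> carrier G" "adapted G \<mu>"
    and h: "mean_value G \<mu> h" "\<And>x. x \<in> carrier G \<Longrightarrow> norm (h x) \<le> B"
    and x: "x \<in> carrier G"
  shows "h x = h \<one>"
proof -
  have "right_invariant h (lower_central_series G 0)"
  proof (rule right_invariant_lower_central_seriesI[OF _ nil])
    fix n assume inv: "right_invariant h (lower_central_series G (Suc n))"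
    show "right_invariant h (lower_central_series G n)"
      unfolding right_invariant_def
    proof (intro ballI)
      fix x z assume x: "x \<in> carrier G" and z: "z \<in> lower_central_series G n"
      have zc: "z \<in> carrier G"
        using z by (rule lower_central_series_in_carrier)
      define v where "v x = h (x \<otimes> z) - h x" for x
      have v: "mean_value G \<mu> v"
        unfolding v_def using inv h(1) z by (rule mean_value_right_diff)
      have bd: "norm (h x - h y) \<le> 2 * B" if "x \<in> carrier G" "y \<in> carrier G" for x y
        using h(2)[OF that(1)] h(2)[OF that(2)] norm_triangle_ineq4[of "h x" "h y"] by simp
      \<comment> \<open>The average runs over \<open>z [^] j\<close> for \<open>j < N\<close>. The
        telescoped sum is a difference of two values of \<open>h\<close>, whence the numerator
        \<open>2 * B\<close>.\<close>
      have le: "norm (v x) \<le> 2 * B / real N" if N: "N > 0" for N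
      proof (rule mean_value_norm_le_average[OF mu v _ _ N])
        show "norm (v y) \<le> 2 * B" if "y \<in> carrier G" for y
          unfolding v_def using that zc by (intro bd) auto
        show "norm (\<Sum>j<N. v (y \<otimes> z [^] j)) \<le> real N * (2 * B / real N)" if y: "y \<in> carrier G" for y
        proof -
          have "(\<Sum>j<N. v (y \<otimes> z [^] j)) = (\<Sum>j<N. h (y \<otimes> z [^] Suc j) - h (y \<otimes> z [^] j))"
            unfolding v_def using y zc by (simp add: m_assoc)
          also have "\<dots> = h (y \<otimes> z [^] N) - h (y \<otimes> z [^] (0::nat))"
            by (rule sum_lessThan_telescope)
          also have "norm \<dots> \<le> 2 * B"
            using y zc by (intro bd) auto
          finally show ?thesis using N by simp
        qed
      qed (use zc x in auto)
      have "(\<lambda>N. 2 * B / real N) \<longlonglongrightarrow> 0"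
        by (rule lim_const_over_n)
      then have "norm (v x) \<le> 0"
        by (rule Lim_bounded2[where N = 1]) (use le in auto)
      then show "h (x \<otimes> z) = h x"
        by (simp add: v_def)
    qed
  qed auto
  \<comment> \<open>Term 0 is the whole group, so invariance under it is constancy.\<close>
  then have "h (\<one> \<otimes> x) = h \<one>"
    unfolding right_invariant_def lower_central_series.simps using x one_closed by blast
  then show ?thesis using x by simp
qed

section \<open>Linear and quadratic growth along powers\<close>

lemma bounded_right_diff_pow:
  fixes f :: "'a \<Rightarrow> 'e::real_normed_vector"
  assumes "y \<in> carrier G" and C: "\<And>x. x \<in> carrier G \<Longrightarrow> norm (f (x \<otimes> y) - f x) \<le> C"
    and "x \<in> carrier G"
  shows "norm (f (x \<otimes> y [^] (n::nat)) - f x) \<le> real n * C"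
proof (induction n)
  case (Suc n)
  have "f (x \<otimes> y [^] Suc n) - f x =
      (f (x \<otimes> y [^] n \<otimes> y) - f (x \<otimes> y [^] n)) + (f (x \<otimes> y [^] n) - f x)"
    using assms by (simp add: m_assoc)
  also have "norm \<dots> \<le> C + real n * C"
    using Suc C[of "x \<otimes> y [^] n"] assms by (intro norm_triangle_mono) auto
  finally show ?case
    by (simp add: algebra_simps)
qed (use assms in auto)

text \<open>The Lipschitz condition speaks of generators only; increments add up along a word for
  \<open>y\<close>. The bound depends on \<open>y\<close> but is uniform in
  \<open>x\<close>.\<close>

lemma lipschitz_map_bounded_right_diff:
  fixes f :: "'a \<Rightarrow> 'e::real_normed_vector"
  assumes S: "symmetric_generating_set G S" and f: "lipschitz_map G S f" and y: "y \<in> carrier G"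
  shows "\<exists>C. \<forall>x\<in>carrier G. norm (f (x \<otimes> y) - f x) \<le> C"
proof -
  obtain L where L: "\<And>x s. x \<in> carrier G \<Longrightarrow> s \<in> S \<Longrightarrow> norm (f (x \<otimes> s) - f x) \<le> L"
    using f unfolding lipschitz_map_def bdd_above_def by blast
  have S': "S \<subseteq> carrier G" "\<And>s. s \<in> S \<Longrightarrow> inv s \<in> S" "generate G S = carrier G"
    using S unfolding symmetric_generating_set_def by auto
  from y have "y \<in> generate G S"
    using S' by simp
  then show ?thesis
  proof induction
    case one
    show ?case by (intro exI[of _ 0]) simp
  next
    case (eng g h)
    then obtain C D where CD: "\<forall>x\<in>carrier G. norm (f (x \<otimes> g) - f x) \<le> C"
      "\<forall>x\<in>carrier G. norm (f (x \<otimes> h) - f x) \<le> D"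
      by blast
    have gh: "g \<in> carrier G" "h \<in> carrier G"
      using eng S' by auto
    have "norm (f (x \<otimes> (g \<otimes> h)) - f x) \<le> D + C" if x: "x \<in> carrier G" for x
    proof -
      have "f (x \<otimes> (g \<otimes> h)) - f x = (f (x \<otimes> g \<otimes> h) - f (x \<otimes> g)) + (f (x \<otimes> g) - f x)"
        using x gh by (simp add: m_assoc)
      also have "norm \<dots> \<le> D + C"
        using CD x gh by (intro norm_triangle_mono) auto
      finally show ?thesis .
    qed
    then show ?case by blast
  qed (use L S' in blast)+
qed

text \<open>Carrying \<open>m\<close> letters \<open>a\<close> past \<open>n\<close> letters
  \<open>b\<close> takes \<open>m * n\<close> exchanges of neighbours, each adding \<open>c\<close>.
  The words \<open>u\<close> and \<open>v\<close> on both sides let the exchange rule act in the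
  middle of a product.\<close>

lemma commuting_powers:
  fixes f :: "'a \<Rightarrow> 'e::real_vector"
  assumes ab: "a \<in> carrier G" "b \<in> carrier G"
    and swap: "\<And>u v. u \<in> carrier G \<Longrightarrow> v \<in> carrier G \<Longrightarrow> f (u \<otimes> (a \<otimes> b \<otimes> v)) = f (u \<otimes> (b \<otimes> a \<otimes> v)) + c"
    and uv: "u \<in> carrier G" "v \<in> carrier G"
  shows "f (u \<otimes> (a [^] (m::nat) \<otimes> b [^] (n::nat) \<otimes> v)) =
           f (u \<otimes> (b [^] n \<otimes> a [^] m \<otimes> v)) + (real m * real n) *\<^sub>R c"
proof -
  \<comment> \<open>A single \<open>a\<close> is carried past all the letters
    \<open>b\<close>.\<close>
  have 1: "f (u \<otimes> (a \<otimes> b [^] n \<otimes> v)) = f (u \<otimes> (b [^] n \<otimes> a \<otimes> v)) + real n *\<^sub>R c"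
    if "u \<in> carrier G" "v \<in> carrier G" for u v
    using that
  proof (induction n arbitrary: v)
    case (Suc n)
    have "f (u \<otimes> (a \<otimes> b [^] Suc n \<otimes> v)) = f (u \<otimes> (a \<otimes> b [^] n \<otimes> (b \<otimes> v)))"
      using Suc.prems ab by (simp add: m_assoc)
    also have "\<dots> = f (u \<otimes> (b [^] n \<otimes> a \<otimes> (b \<otimes> v))) + real n *\<^sub>R c"
      using Suc.prems ab by (intro Suc.IH) auto
    also have "f (u \<otimes> (b [^] n \<otimes> a \<otimes> (b \<otimes> v))) = f ((u \<otimes> b [^] n) \<otimes> (a \<otimes> b \<otimes> v))"
      using Suc.prems ab by (simp add: m_assoc)
    also have "\<dots> = f ((u \<otimes> b [^] n) \<otimes> (b \<otimes> a \<otimes> v)) + c"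
      using Suc.prems ab by (intro swap) auto
    also have "(u \<otimes> b [^] n) \<otimes> (b \<otimes> a \<otimes> v) = u \<otimes> (b [^] Suc n \<otimes> a \<otimes> v)"
      using Suc.prems ab by (simp add: m_assoc)
    finally show ?case
      by (simp add: algebra_simps)
  qed (use ab in auto)
  show ?thesis
    using uv
  proof (induction m arbitrary: v)
    case (Suc m)
    have "f (u \<otimes> (a [^] Suc m \<otimes> b [^] n \<otimes> v)) = f ((u \<otimes> a [^] m) \<otimes> (a \<otimes> b [^] n \<otimes> v))"
      using Suc.prems ab by (simp add: m_assoc)
    also have "\<dots> = f ((u \<otimes> a [^] m) \<otimes> (b [^] n \<otimes> a \<otimes> v)) + real n *\<^sub>R c"
      using Suc.prems ab by (intro 1) auto
    also have "(u \<otimes> a [^] m) \<otimes> (b [^] n \<otimes> a \<otimes> v) = u \<otimes> (a [^] m \<otimes> b [^] n \<otimes> (a \<otimes> v))"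
      using Suc.prems ab by (simp add: m_assoc)
    also have "f \<dots> = f (u \<otimes> (b [^] n \<otimes> a [^] m \<otimes> (a \<otimes> v))) + (real m * real n) *\<^sub>R c"
      using Suc.prems ab by (intro Suc.IH) auto
    also have "u \<otimes> (b [^] n \<otimes> a [^] m \<otimes> (a \<otimes> v)) = u \<otimes> (b [^] n \<otimes> a [^] Suc m \<otimes> v)"
      using Suc.prems ab by (simp add: m_assoc)
    finally show ?case
      by (simp add: algebra_simps)
  qed (use ab in auto)
qed

lemma linear_bound_square_zero:
  fixes c :: "'e::real_normed_vector"
  assumes "\<And>n::nat. real n * real n * norm c \<le> real n * K"
  shows "c = 0"
proof -
  have "norm c \<le> K / real n" if "n \<ge> 1" for n
    using assms[of n] that by (simp add: field_simps mult_le_cancel_left_pos)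
  then have "norm c \<le> 0"
    using Lim_bounded2[OF lim_const_over_n, of 1 "norm c" K] by blast
  then show ?thesis by simp
qed

lemma lipschitz_harmonic_right_diff_constant:
  fixes f :: "'a \<Rightarrow> 'e::real_normed_vector"
  assumes nil: "lower_central_series G k = {\<one>}"
    and mu: "set_pmf \<mu> \<subseteq> carrier G" "adapted G \<mu>"
    and S: "symmetric_generating_set G S" and f: "lipschitz_map G S f" "mean_value G \<mu> f"
    and inv: "right_invariant f (lower_central_series G (Suc n))"
    and z: "z \<in> lower_central_series G n" and x: "x \<in> carrier G"
  shows "f (x \<otimes> z) - f x = f z - f \<one>"
proof -
  have zc: "z \<in> carrier G"
    using z by (rule lower_central_series_in_carrier)
  obtain C where C: "\<And>x. x \<in> carrier G \<Longrightarrow> norm (f (x \<otimes> z) - f x) \<le> C"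
    using lipschitz_map_bounded_right_diff[OF S f(1) zc] by blast
  have "f (x \<otimes> z) - f x = f (\<one> \<otimes> z) - f \<one>"
    by (rule bounded_mean_value_constant[OF nil mu mean_value_right_diff[OF inv f(2) z] C x]) auto
  then show ?thesis
    using zc by simp
qed

text \<open>
  For \<open>w = [a, b]\<close>, moving the \<open>m\<close>-th power of \<open>a\<close> past that of \<open>b\<close> changes \<open>f\<close> by
  \<open>m\<^sup>2 (f w - f 1)\<close>, while the Lipschitz condition only allows a change that is linear in \<open>m\<close>.
\<close>

lemma lipschitz_harmonic_right_invariant_step:
  fixes f :: "'a \<Rightarrow> 'e::real_normed_vector"
  assumes nil: "lower_central_series G k = {\<one>}"
    and mu: "set_pmf \<mu> \<subseteq> carrier G" "adapted G \<mu>"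
    and S: "symmetric_generating_set G S" and f: "lipschitz_map G S f" "mean_value G \<mu> f"
    and inv: "right_invariant f (lower_central_series G (Suc (Suc n)))"
  shows "right_invariant f (lower_central_series G (Suc n))"
proof -
  have const: "f (x \<otimes> z) = f x + (f z - f \<one>)"
    if "z \<in> lower_central_series G (Suc n)" "x \<in> carrier G" for x z
    using lipschitz_harmonic_right_diff_constant[OF nil mu S f inv that] by (simp add: algebra_simps)
  \<comment> \<open>Invariance is shown first under these commutators and then passed to the
    subgroup they generate.\<close>
  define W where "W = (\<Union>h\<in>lower_central_series G n. \<Union>g\<in>carrier G. {h \<otimes> g \<otimes> inv h \<otimes> inv g})"
  have W: "f (x \<otimes> w) = f x" if "w \<in> W" and x: "x \<in> carrier G" for x w
  proof -
    have wl: "w \<in> lower_central_series G (Suc n)"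
      using that by (simp add: W_def generate.incl)
    from \<open>w \<in> W\<close> obtain a b where a: "a \<in> lower_central_series G n" and b: "b \<in> carrier G"
      and w: "w = a \<otimes> b \<otimes> inv a \<otimes> inv b"
      unfolding W_def by blast
    note ab = lower_central_series_in_carrier[OF a] b
    have wc: "w \<in> carrier G"
      using ab w by simp
    have wba: "w \<otimes> (b \<otimes> a) = a \<otimes> b"
      using ab unfolding w by (simp add: m_assoc mult_inv_cancel)
    define c where "c = f w - f \<one>"
    have swap: "f (u \<otimes> (a \<otimes> b \<otimes> v)) = f (u \<otimes> (b \<otimes> a \<otimes> v)) + c"
      if uv: "u \<in> carrier G" "v \<in> carrier G" for u v
    proof -
      \<comment> \<open>Writing \<open>a \<otimes> b\<close> as
        \<open>w \<otimes> (b \<otimes> a)\<close> leaves \<open>w\<close> inside the word. Modulo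
        the next term it is central, so it moves to the right end, where it adds
        \<open>c\<close>.\<close>
      have "u \<otimes> (a \<otimes> b \<otimes> v) = u \<otimes> w \<otimes> (b \<otimes> a \<otimes> v)"
        using uv ab wc wba by (metis m_assoc m_closed)
      also have "f \<dots> = f (u \<otimes> (b \<otimes> a \<otimes> v) \<otimes> w)"
        by (rule right_invariant_commute[OF inv wl]) (use uv ab in auto)
      also have "\<dots> = f (u \<otimes> (b \<otimes> a \<otimes> v)) + c"
        unfolding c_def by (rule const[OF wl]) (use uv ab in auto)
      finally show ?thesis .
    qed
    obtain A where A: "\<And>x. x \<in> carrier G \<Longrightarrow> norm (f (x \<otimes> a) - f x) \<le> A"
      using lipschitz_map_bounded_right_diff[OF S f(1) ab(1)] by blast
    obtain B where B: "\<And>x. x \<in> carrier G \<Longrightarrow> norm (f (x \<otimes> b) - f x) \<le> B"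
      using lipschitz_map_bounded_right_diff[OF S f(1) ab(2)] by blast
    \<comment> \<open>Both \<open>f (a [^] m \<otimes> b [^] m)\<close> and
      \<open>f (b [^] m \<otimes> a [^] m)\<close> lie within \<open>real m * (A + B)\<close> of
      \<open>f \<one>\<close>, hence the factor 2.\<close>
    have "real m * real m * norm c \<le> real m * (2 * (A + B))" for m :: nat
    proof -
      have 1: "norm (f (a [^] m \<otimes> b [^] m) - f \<one>) \<le> real m * B + real m * A"
      proof -
        have "norm (f (a [^] m \<otimes> b [^] m) - f (a [^] m) + (f (\<one> \<otimes> a [^] m) - f \<one>)) \<le> real m * B + real m * A"
          using ab by (intro norm_triangle_mono bounded_right_diff_pow A B) auto
        then show ?thesis using ab by simp
      qed
      have 2: "norm (f (b [^] m \<otimes> a [^] m) - f \<one>) \<le> real m * A + real m * B"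
      proof -
        have "norm (f (b [^] m \<otimes> a [^] m) - f (b [^] m) + (f (\<one> \<otimes> b [^] m) - f \<one>)) \<le> real m * A + real m * B"
          using ab by (intro norm_triangle_mono bounded_right_diff_pow A B) auto
        then show ?thesis using ab by simp
      qed
      have eq: "(real m * real m) *\<^sub>R c = (f (a [^] m \<otimes> b [^] m) - f \<one>) - (f (b [^] m \<otimes> a [^] m) - f \<one>)"
        using commuting_powers[OF ab swap, of \<one> \<one> m m] ab by simp
      have "norm ((real m * real m) *\<^sub>R c) \<le> (real m * B + real m * A) + (real m * A + real m * B)"
        unfolding eq using 1 2 norm_triangle_ineq4[of "f (a [^] m \<otimes> b [^] m) - f \<one>" "f (b [^] m \<otimes> a [^] m) - f \<one>"]
        by linarith
      then show ?thesis
        by (simp add: algebra_simps)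
    qed
    then have "c = 0"
      by (rule linear_bound_square_zero)
    then show ?thesis
      using const[OF wl x] by (simp add: c_def)
  qed
  have Wc: "W \<subseteq> carrier G"
    unfolding W_def using lower_central_series_in_carrier by auto
  have "f (x \<otimes> w) = f x" if "w \<in> generate G W" "x \<in> carrier G" for w x
    using that
  proof (induction arbitrary: x)
    case (inv h)
    \<comment> \<open>Invariance under \<open>h\<close> is used at the point
      \<open>x \<otimes> inv h\<close>.\<close>
    then have "f (x \<otimes> inv h \<otimes> h) = f (x \<otimes> inv h)"
      using Wc by (intro W) auto
    then show ?case
      using inv Wc by (auto simp: m_assoc subset_iff)
  next
    case (eng g h)
    then have "g \<in> carrier G" "h \<in> carrier G"
      using generate_in_carrier[OF Wc] by auto
    with eng show ?case
      by (simp flip: m_assoc)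
  qed (use W in auto)
  then show ?thesis
    by (simp add: right_invariant_def W_def)
qed

theorem lipschitz_harmonic_additive:
  fixes f :: "'a \<Rightarrow> 'e::real_normed_vector"
  assumes nil: "lower_central_series G k = {\<one>}"
    and mu: "set_pmf \<mu> \<subseteq> carrier G" "adapted G \<mu>"
    and S: "symmetric_generating_set G S" and f: "lipschitz_map G S f" "mean_value G \<mu> f"
    and xy: "x \<in> carrier G" "y \<in> carrier G"
  shows "f (x \<otimes> y) - f \<one> = (f x - f \<one>) + (f y - f \<one>)"
proof -
  have "right_invariant f (lower_central_series G (Suc 0))"
  \<comment> \<open>The descent to index \<open>Suc 0\<close> requires \<open>Suc 0 \<le> k\<close>;
    for \<open>k = 0\<close> the group is trivial.\<close>
  proof (cases k)
    case 0
    then have "carrier G = {\<one>}"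
      using nil by simp
    then have "h = \<one>" if "h \<in> lower_central_series G (Suc 0)" for h
      using lower_central_series_in_carrier[OF that] by simp
    then show ?thesis
      unfolding right_invariant_def by (metis r_one)
  next
    case (Suc j)
    show ?thesis
    proof (rule right_invariant_lower_central_seriesI[OF _ nil])
      fix n assume "right_invariant f (lower_central_series G (Suc n))" "Suc 0 \<le> n"
      then show "right_invariant f (lower_central_series G n)"
        using lipschitz_harmonic_right_invariant_step[OF nil mu S f] by (cases n) auto
    qed (use Suc in simp)
  qed
  \<comment> \<open>Term 0 is the whole group, so any \<open>y\<close> may act as the translating
    element.\<close>
  from lipschitz_harmonic_right_diff_constant[OF nil mu S f this, of y x] xy
  show ?thesis by (simp add: algebra_simps)
qed

end

section \<open>The real tensor product\<close>

lemmas frag_keys_induct = free_Abelian_group_induct[consumes 1, case_names zero diff gen]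

context group
begin

section \<open>The bilinearity relations and their cosets\<close>

lemma tensor_real_relators_in_carrier:
  "{frag_of (a \<otimes> b, t) - frag_of (a, t) - frag_of (b, t) | a b t. a \<in> carrier G \<and> b \<in> carrier G} \<union>
   {frag_of (a, s + t) - frag_of (a, s) - frag_of (a, t) | a s t. a \<in> carrier G}
   \<subseteq> carrier (free_Abelian_group (carrier G \<times> (UNIV :: real set)))"
  using keys_diff[of "frag_of _ - frag_of _" "frag_of _"] keys_diff[of "frag_of _" "frag_of _"]
  by (auto dest!: subsetD[OF keys_diff])

lemma tensor_real_relations_subgroup:
  "subgroup (tensor_real_relations G) (free_Abelian_group (carrier G \<times> UNIV))"
  unfolding tensor_real_relations_def
  by (rule group.generate_is_subgroup[OF group_free_Abelian_group tensor_real_relators_in_carrier])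

lemma tensor_real_relations_keys:
  "r \<in> tensor_real_relations G \<Longrightarrow> Poly_Mapping.keys r \<subseteq> carrier G \<times> UNIV"
  using subsetD[OF subgroup.subset[OF tensor_real_relations_subgroup], of r] by simp

lemma tensor_real_relations_zero: "0 \<in> tensor_real_relations G"
  using subgroup.one_closed[OF tensor_real_relations_subgroup] by simp

lemma tensor_real_relations_add:
  "r \<in> tensor_real_relations G \<Longrightarrow> s \<in> tensor_real_relations G \<Longrightarrow> r + s \<in> tensor_real_relations G"
  using subgroup.m_closed[OF tensor_real_relations_subgroup] by simp

lemma tensor_real_relations_minus:
  "r \<in> tensor_real_relations G \<Longrightarrow> - r \<in> tensor_real_relations G"
  using subgroup.m_inv_closed[OF tensor_real_relations_subgroup, of r]
  by (simp add: tensor_real_relations_keys)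

lemma tensor_real_relations_diff:
  "r \<in> tensor_real_relations G \<Longrightarrow> s \<in> tensor_real_relations G \<Longrightarrow> r - s \<in> tensor_real_relations G"
  using tensor_real_relations_add[of r "- s"] tensor_real_relations_minus[of s] by simp

lemma tensor_real_relations_sum:
  "(\<And>i. i \<in> I \<Longrightarrow> r i \<in> tensor_real_relations G) \<Longrightarrow> sum r I \<in> tensor_real_relations G"
  by (induction I rule: infinite_finite_induct)
    (auto intro: tensor_real_relations_zero tensor_real_relations_add)

lemma tensor_real_relation_left:
  assumes "a \<in> carrier G" "b \<in> carrier G"
  shows "frag_of (a \<otimes> b, t) - frag_of (a, t) - frag_of (b, t) \<in> tensor_real_relations G"
  unfolding tensor_real_relations_def by (intro generate.incl) (use assms in blast)

lemma tensor_real_relation_right: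
  assumes "a \<in> carrier G"
  shows "frag_of (a, s + t) - frag_of (a, s) - frag_of (a, t) \<in> tensor_real_relations G"
  unfolding tensor_real_relations_def by (intro generate.incl) (use assms in blast)

text \<open>Closure under differences covers inverses and products alike, as
  \<open>- h = 0 - h\<close> and \<open>g + h = g - (- h)\<close>.\<close>

lemma tensor_real_relations_induct [consumes 1, case_names left right diff zero]:
  assumes "r \<in> tensor_real_relations G"
    and "\<And>a b t. a \<in> carrier G \<Longrightarrow> b \<in> carrier G \<Longrightarrow>
           P (frag_of (a \<otimes> b, t) - frag_of (a, t) - frag_of (b, t))"
    and "\<And>a s t. a \<in> carrier G \<Longrightarrow> P (frag_of (a, s + t) - frag_of (a, s) - frag_of (a, t))"
    and diff: "\<And>r s. Poly_Mapping.keys r \<subseteq> carrier G \<times> UNIV \<Longrightarrow>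
           Poly_Mapping.keys s \<subseteq> carrier G \<times> UNIV \<Longrightarrow> P r \<Longrightarrow> P s \<Longrightarrow> P (r - s)"
    and zero: "P 0"
  shows "P r"
proof -
  have keys: "Poly_Mapping.keys r \<subseteq> carrier G \<times> UNIV"
    if "r \<in> {frag_of (a \<otimes> b, t) - frag_of (a, t) - frag_of (b, t) | a b t. a \<in> carrier G \<and> b \<in> carrier G} \<union>
        {frag_of (a, s + t) - frag_of (a, s) - frag_of (a, t) | a s t. a \<in> carrier G}"
    for r :: "('a \<times> real) \<Rightarrow>\<^sub>0 int"
    using subsetD[OF tensor_real_relators_in_carrier that] by simp
  have minus: "P (- r)" if "P r" "Poly_Mapping.keys r \<subseteq> carrier G \<times> UNIV" for r
    using diff[of 0 r] that zero by simp
  from assms(1) have "P r \<and> Poly_Mapping.keys r \<subseteq> carrier G \<times> UNIV"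
    unfolding tensor_real_relations_def
  proof induction
    case (incl h)
    then show ?case
      using keys[OF incl] assms(2,3) by blast
  next
    case (inv h)
    then have "P h"
      using assms(2,3) by blast
    then show ?case
      using minus keys[OF inv] by simp
  next
    case (eng g h)
    then show ?case
      using diff[of g "- h"] minus[of h] keys_add[of g h] by auto
  qed (simp add: zero)
  then show ?thesis by simp
qed

lemma tensor_real_class_eq:
  "tensor_real_class G c = (\<lambda>r. r + c) ` tensor_real_relations G"
  by (auto simp: tensor_real_class_def r_coset_def)

lemma tensor_real_class_eq_iff:
  "tensor_real_class G c = tensor_real_class G d \<longleftrightarrow> c - d \<in> tensor_real_relations G"
proof
  assume eq: "tensor_real_class G c = tensor_real_class G d"
  have "c \<in> tensor_real_class G c"
    unfolding tensor_real_class_eq using tensor_real_relations_zero by force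
  then show "c - d \<in> tensor_real_relations G"
    unfolding eq by (auto simp: tensor_real_class_eq)
next
  assume cd: "c - d \<in> tensor_real_relations G"
  have sub: "tensor_real_class G c \<subseteq> tensor_real_class G d" if "c - d \<in> tensor_real_relations G" for c d
  proof
    fix x assume "x \<in> tensor_real_class G c"
    then obtain r where r: "r \<in> tensor_real_relations G" "x = r + c"
      by (auto simp: tensor_real_class_eq)
    then have "x = (r + (c - d)) + d" "r + (c - d) \<in> tensor_real_relations G"
      using that by (auto intro: tensor_real_relations_add)
    then show "x \<in> tensor_real_class G d"
      unfolding tensor_real_class_eq by blast
  qed
  show "tensor_real_class G c = tensor_real_class G d"
    using sub[OF cd] sub[of d c] tensor_real_relations_minus[OF cd] by simp
qed

lemma mem_tensor_real_class_iff: "c \<in> tensor_real_class G d \<longleftrightarrow> tensor_real_class G c = tensor_real_class G d"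
proof -
  have "c \<in> tensor_real_class G d \<longleftrightarrow> c - d \<in> tensor_real_relations G"
    by (force simp: tensor_real_class_eq image_iff)
  then show ?thesis by (simp add: tensor_real_class_eq_iff)
qed

lemma carrier_tensor_real:
  "carrier (tensor_real G) = tensor_real_class G ` {c. Poly_Mapping.keys c \<subseteq> carrier G \<times> UNIV}"
  by (auto simp: tensor_real_def Let_def FactGroup_def RCOSETS_def tensor_real_class_def
      free_Abelian_group_def)

lemma zero_tensor_real: "\<zero>\<^bsub>tensor_real G\<^esub> = tensor_real_class G 0"
  by (simp add: tensor_real_def Let_def FactGroup_def tensor_real_class_eq)

lemma add_tensor_real:
  "tensor_real_class G c \<oplus>\<^bsub>tensor_real G\<^esub> tensor_real_class G d = tensor_real_class G (c + d)"
proof -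
  have "tensor_real_class G c \<oplus>\<^bsub>tensor_real G\<^esub> tensor_real_class G d =
      {x + y | x y. x \<in> tensor_real_class G c \<and> y \<in> tensor_real_class G d}"
    by (auto simp: tensor_real_def Let_def FactGroup_def set_mult_def)
  also have "\<dots> = tensor_real_class G (c + d)"
  proof (intro equalityI subsetI)
    fix z assume "z \<in> {x + y | x y. x \<in> tensor_real_class G c \<and> y \<in> tensor_real_class G d}"
    then obtain r s where rs: "r \<in> tensor_real_relations G" "s \<in> tensor_real_relations G" "z = (r + c) + (s + d)"
      by (auto simp: tensor_real_class_eq)
    then have "z = (r + s) + (c + d)" "r + s \<in> tensor_real_relations G"
      by (auto intro: tensor_real_relations_add)
    then show "z \<in> tensor_real_class G (c + d)"
      unfolding tensor_real_class_eq by blast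
  next
    fix z assume "z \<in> tensor_real_class G (c + d)"
    then obtain r where r: "r \<in> tensor_real_relations G" "z = (r + c) + (0 + d)"
      by (auto simp: tensor_real_class_eq add.assoc)
    then show "z \<in> {x + y | x y. x \<in> tensor_real_class G c \<and> y \<in> tensor_real_class G d}"
      unfolding tensor_real_class_eq using tensor_real_relations_zero by blast
  qed
  finally show ?thesis .
qed

abbreviation tensor_scale :: "real \<Rightarrow> (('a \<times> real) \<Rightarrow>\<^sub>0 int) \<Rightarrow> (('a \<times> real) \<Rightarrow>\<^sub>0 int)" where
  "tensor_scale r \<equiv> frag_extend (\<lambda>(a, t). frag_of (a, r * t))"

text \<open>Scaling carries each generating relation to one of the same kind; this makes scalar
  multiplication well defined on classes.\<close>

lemma tensor_scale_relations:
  assumes "c \<in> tensor_real_relations G"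
  shows "tensor_scale r c \<in> tensor_real_relations G"
  using assms
proof (induction rule: tensor_real_relations_induct)
  case (left a b t)
  then show ?case
    by (simp add: frag_extend_diff tensor_real_relation_left)
next
  case (right a s t)
  then show ?case
    by (simp add: frag_extend_diff distrib_left tensor_real_relation_right)
qed (auto simp: frag_extend_diff intro: tensor_real_relations_diff tensor_real_relations_zero)

text \<open>The union that defines the scalar multiple runs over representatives, which all give the
  same class.\<close>

lemma smult_tensor_real:
  "r \<odot>\<^bsub>tensor_real G\<^esub> tensor_real_class G c = tensor_real_class G (tensor_scale r c)"
proof -
  have "tensor_real_class G (tensor_scale r c') = tensor_real_class G (tensor_scale r c)"
    if "c' \<in> tensor_real_class G c" for c'
  proof -
    have "c' - c \<in> tensor_real_relations G"
      using that by (simp add: mem_tensor_real_class_iff tensor_real_class_eq_iff)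
    from tensor_scale_relations[OF this, of r] show ?thesis
      by (simp add: tensor_real_class_eq_iff frag_extend_diff)
  qed
  moreover have "c \<in> tensor_real_class G c"
    by (simp add: mem_tensor_real_class_iff)
  ultimately show ?thesis
    unfolding tensor_real_def Let_def module.simps by blast
qed

lemma abelian_monoid_tensor_real: "abelian_monoid (tensor_real G)"
proof (rule abelian_monoidI)
  fix x y assume "x \<in> carrier (tensor_real G)" "y \<in> carrier (tensor_real G)"
  then obtain c d where cd: "x = tensor_real_class G c" "y = tensor_real_class G d"
    "Poly_Mapping.keys c \<subseteq> carrier G \<times> UNIV" "Poly_Mapping.keys d \<subseteq> carrier G \<times> UNIV"
    by (auto simp: carrier_tensor_real)
  then show "x \<oplus>\<^bsub>tensor_real G\<^esub> y \<in> carrier (tensor_real G)"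
    using keys_add[of c d] by (auto simp: add_tensor_real carrier_tensor_real)
  show "x \<oplus>\<^bsub>tensor_real G\<^esub> y = y \<oplus>\<^bsub>tensor_real G\<^esub> x"
    by (simp add: cd add_tensor_real add.commute)
qed (auto simp: carrier_tensor_real zero_tensor_real add_tensor_real add.assoc)

lemma pure_tensor_closed: "a \<in> carrier G \<Longrightarrow> pure_tensor G a t \<in> carrier (tensor_real G)"
  by (auto simp: pure_tensor_def carrier_tensor_real)

lemma smult_pure_tensor:
  "r \<odot>\<^bsub>tensor_real G\<^esub> pure_tensor G a t = pure_tensor G a (r * t)"
  by (simp add: pure_tensor_def smult_tensor_real)

lemma pure_tensor_mult:
  assumes "a \<in> carrier G" "b \<in> carrier G"
  shows "pure_tensor G (a \<otimes> b) t = pure_tensor G a t \<oplus>\<^bsub>tensor_real G\<^esub> pure_tensor G b t"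
  using tensor_real_relation_left[OF assms, of t]
  by (simp add: pure_tensor_def add_tensor_real tensor_real_class_eq_iff diff_diff_eq)

text \<open>Universal property of the tensor product, for the map
  \<open>(a, t) \<mapsto> t *\<^sub>R l a\<close>: its additive extension \<open>\<Phi>\<close>
  kills the relations by biadditivity.\<close>

lemma tensor_real_lift:
  fixes l :: "'a \<Rightarrow> 'e::real_vector"
  assumes l: "\<And>a b. a \<in> carrier G \<Longrightarrow> b \<in> carrier G \<Longrightarrow> l (a \<otimes> b) = l a + l b"
  obtains L where "real_linear_on (tensor_real G) L"
    and "\<forall>a\<in>carrier G. \<forall>t. L (pure_tensor G a t) = t *\<^sub>R l a"
proof -
  define \<Phi> :: "('a \<times> real \<Rightarrow>\<^sub>0 int) \<Rightarrow> 'e" where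
    "\<Phi> c = (\<Sum>p\<in>Poly_Mapping.keys c. real_of_int (Poly_Mapping.lookup c p) *\<^sub>R (snd p *\<^sub>R l (fst p)))" for c
  have add: "\<Phi> (c + d) = \<Phi> c + \<Phi> d" for c d
    unfolding \<Phi>_def
    by (rule setsum_keys_plus_distrib[where f = "\<lambda>p n. real_of_int n *\<^sub>R (snd p *\<^sub>R l (fst p))"])
      (auto simp: algebra_simps)
  have diff: "\<Phi> (c - d) = \<Phi> c - \<Phi> d" for c d
    using add[of "c - d" d] by simp
  have gen: "\<Phi> (frag_of (a, t)) = t *\<^sub>R l a" for a t
    by (simp add: \<Phi>_def)
  have zero: "\<Phi> 0 = 0"
    by (simp add: \<Phi>_def)
  have rel: "\<Phi> r = 0" if "r \<in> tensor_real_relations G" for r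
    using that by (induction rule: tensor_real_relations_induct)
      (auto simp: diff gen l zero scaleR_right_distrib scaleR_left_distrib)
  have scale: "\<Phi> (tensor_scale r c) = r *\<^sub>R \<Phi> c" for r c
  proof (rule frag_induction[of c UNIV "\<lambda>c. \<Phi> (tensor_scale r c) = r *\<^sub>R \<Phi> c"])
    show "\<Phi> (tensor_scale r (frag_of p)) = r *\<^sub>R \<Phi> (frag_of p)" for p :: "'a \<times> real"
      by (cases p) (simp add: gen)
  qed (auto simp: zero diff frag_extend_diff scaleR_diff_right)
  \<comment> \<open>The choice is harmless: representatives of one class differ by a relation, on
    which \<open>\<Phi>\<close> vanishes.\<close>
  define L where "L X = \<Phi> (SOME c. c \<in> X)" for X
  have L: "L (tensor_real_class G c) = \<Phi> c" for c
  proof -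
    have "(SOME d. d \<in> tensor_real_class G c) \<in> tensor_real_class G c"
      by (rule someI[of _ c]) (simp add: mem_tensor_real_class_iff)
    then have "(SOME d. d \<in> tensor_real_class G c) - c \<in> tensor_real_relations G"
      by (simp add: mem_tensor_real_class_iff tensor_real_class_eq_iff)
    from rel[OF this] show ?thesis
      by (simp add: L_def diff)
  qed
  show ?thesis
  proof (rule that[of L])
    show "real_linear_on (tensor_real G) L"
      unfolding real_linear_on_def carrier_tensor_real
      by (auto simp: add_tensor_real smult_tensor_real L add scale)
  qed (simp add: pure_tensor_def L gen)
qed

text \<open>
  The carrier of the tensor product is not a type, so its linear functionals are obtained from those
  of the vector space of finitely supported functions, which \<open>tensor_comb\<close> maps onto it.
\<close>

definition tensor_term :: "'a \<Rightarrow> real \<Rightarrow> ('a \<times> real) \<Rightarrow>\<^sub>0 int" where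
  "tensor_term a t = (if a \<in> carrier G then frag_of (a, t) else 0)"

definition tensor_comb :: "('a \<Rightarrow>\<^sub>0 real) \<Rightarrow> ('a \<times> real) \<Rightarrow>\<^sub>0 int" where
  "tensor_comb c = (\<Sum>a\<in>Poly_Mapping.keys c. tensor_term a (Poly_Mapping.lookup c a))"

lemma tensor_term_add: "tensor_term a (s + t) - tensor_term a s - tensor_term a t \<in> tensor_real_relations G"
  using tensor_real_relation_right tensor_real_relations_zero by (simp add: tensor_term_def)

text \<open>The terms added have coefficient 0 and are trivial modulo relations. This puts
  combinations with different supports over one index set.\<close>

lemma tensor_comb_superset:
  assumes "finite K" "Poly_Mapping.keys c \<subseteq> K"
  shows "tensor_comb c - (\<Sum>a\<in>K. tensor_term a (Poly_Mapping.lookup c a)) \<in> tensor_real_relations G"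
proof -
  have "(\<Sum>a\<in>K. tensor_term a (Poly_Mapping.lookup c a)) =
      (\<Sum>a\<in>K - Poly_Mapping.keys c. tensor_term a (Poly_Mapping.lookup c a)) + tensor_comb c"
    unfolding tensor_comb_def using assms by (simp add: sum.subset_diff)
  moreover have "(\<Sum>a\<in>K - Poly_Mapping.keys c. tensor_term a (Poly_Mapping.lookup c a)) \<in> tensor_real_relations G"
  proof (rule tensor_real_relations_sum)
    fix a assume "a \<in> K - Poly_Mapping.keys c"
    then have "tensor_term a (Poly_Mapping.lookup c a) = tensor_term a 0"
      by (simp add: in_keys_iff)
    \<comment> \<open>The relation for \<open>0 + 0\<close> is minus the term with coefficient
      0.\<close>
    then show "tensor_term a (Poly_Mapping.lookup c a) \<in> tensor_real_relations G"
      using tensor_real_relations_minus[OF tensor_term_add[of a 0 0]] by simp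
  qed
  ultimately show ?thesis
    using tensor_real_relations_minus by simp
qed

lemma tensor_comb_add: "tensor_real_class G (tensor_comb (c + d)) = tensor_real_class G (tensor_comb c + tensor_comb d)"
proof -
  let ?K = "Poly_Mapping.keys c \<union> Poly_Mapping.keys d" and ?R = "tensor_real_relations G"
  let ?\<Sigma> = "\<lambda>c. \<Sum>a\<in>?K. tensor_term a (Poly_Mapping.lookup c a)"
  have "tensor_comb c - ?\<Sigma> c \<in> ?R" "tensor_comb d - ?\<Sigma> d \<in> ?R" "tensor_comb (c + d) - ?\<Sigma> (c + d) \<in> ?R"
    by (rule tensor_comb_superset; simp add: keys_add)+
  note comb = this
  have "?\<Sigma> (c + d) - ?\<Sigma> c - ?\<Sigma> d \<in> ?R"
    unfolding sum_subtractf[symmetric] lookup_add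
    by (intro tensor_real_relations_sum tensor_term_add)
  note R = this
  have "(tensor_comb (c + d) - ?\<Sigma> (c + d)) + (?\<Sigma> (c + d) - ?\<Sigma> c - ?\<Sigma> d)
      - (tensor_comb c - ?\<Sigma> c) - (tensor_comb d - ?\<Sigma> d) \<in> ?R"
    by (rule tensor_real_relations_diff[OF tensor_real_relations_diff[OF
          tensor_real_relations_add[OF comb(3) R] comb(1)] comb(2)])
  then show ?thesis
    unfolding tensor_real_class_eq_iff by (simp add: algebra_simps)
qed

abbreviation comb_scale :: "real \<Rightarrow> ('a \<Rightarrow>\<^sub>0 real) \<Rightarrow> ('a \<Rightarrow>\<^sub>0 real)" where
  "comb_scale r \<equiv> Poly_Mapping.map ((*) r)"

lemma lookup_comb_scale: "Poly_Mapping.lookup (comb_scale r c) a = r * Poly_Mapping.lookup c a"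
  by (simp add: Poly_Mapping.map.rep_eq when_def)

lemma tensor_comb_scale:
  "tensor_real_class G (tensor_comb (comb_scale r c)) = tensor_real_class G (tensor_scale r (tensor_comb c))"
proof -
  have "tensor_scale r (tensor_comb c) =
      (\<Sum>a\<in>Poly_Mapping.keys c. tensor_term a (Poly_Mapping.lookup (comb_scale r c) a))"
    unfolding tensor_comb_def
    by (auto simp: frag_extend_sum tensor_term_def lookup_comb_scale intro!: sum.cong)
  moreover have "Poly_Mapping.keys (comb_scale r c) \<subseteq> Poly_Mapping.keys c"
    by (auto simp: in_keys_iff lookup_comb_scale)
  ultimately show ?thesis
    using tensor_comb_superset[of "Poly_Mapping.keys c" "comb_scale r c"]
    by (simp add: tensor_real_class_eq_iff)
qed

lemma keys_tensor_comb: "Poly_Mapping.keys (tensor_comb c) \<subseteq> carrier G \<times> UNIV"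
proof -
  have "tensor_comb c \<in> carrier (free_Abelian_group (carrier G \<times> UNIV))"
    unfolding tensor_comb_def
    by (rule sum_closed_free_Abelian_group) (auto simp: tensor_term_def)
  then show ?thesis by simp
qed

lemma comb_vector_space: "vector_space comb_scale"
  by unfold_locales (auto intro!: poly_mapping_eqI simp: lookup_comb_scale lookup_add algebra_simps)

text \<open>Every class has a representative with one real coefficient for each group element; a
  generator \<open>(a, t)\<close> comes from \<open>Poly_Mapping.single a t\<close>.\<close>

lemma carrier_tensor_real_comb: "carrier (tensor_real G) = range (\<lambda>c. tensor_real_class G (tensor_comb c))"
proof -
  have "\<exists>c. tensor_real_class G d = tensor_real_class G (tensor_comb c)"
    if "Poly_Mapping.keys d \<subseteq> carrier G \<times> UNIV" for d
    using that
  proof (induction rule: frag_keys_induct)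
    case zero
    show ?case
      by (rule exI[of _ 0]) (simp add: tensor_comb_def)
  next
    case (diff x y)
    from diff.IH obtain c d where cd: "x - tensor_comb c \<in> tensor_real_relations G" "y - tensor_comb d \<in> tensor_real_relations G"
      unfolding tensor_real_class_eq_iff by blast
    \<comment> \<open>Additivity for the pair \<open>c - d\<close> and \<open>d\<close> serves as
      the rule for differences.\<close>
    have "tensor_comb (c - d + d) - (tensor_comb (c - d) + tensor_comb d) \<in> tensor_real_relations G"
      using tensor_comb_add[of "c - d" d] unfolding tensor_real_class_eq_iff .
    from tensor_real_relations_add[OF tensor_real_relations_diff[OF cd] this]
    have "x - y - tensor_comb (c - d) \<in> tensor_real_relations G"
      by (simp add: algebra_simps)
    then show ?case
      unfolding tensor_real_class_eq_iff by (rule exI)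
  next
    case (gen p)
    obtain a t where p: "p = (a, t)" "a \<in> carrier G"
      using gen by auto
    have "tensor_comb (Poly_Mapping.single a t) - tensor_term a t \<in> tensor_real_relations G"
      using tensor_comb_superset[of "{a}" "Poly_Mapping.single a t"] by (auto split: if_splits)
    then have "tensor_real_class G (tensor_comb (Poly_Mapping.single a t)) = tensor_real_class G (frag_of p)"
      using p by (simp add: tensor_real_class_eq_iff tensor_term_def)
    then show ?case
      by metis
  qed
  note ex = this
  show ?thesis
    unfolding carrier_tensor_real
  proof (intro equalityI image_subsetI)
    fix d :: "('a \<times> real) \<Rightarrow>\<^sub>0 int" assume d: "d \<in> {c. Poly_Mapping.keys c \<subseteq> carrier G \<times> UNIV}"
    from d obtain c where "tensor_real_class G d = tensor_real_class G (tensor_comb c)"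
      using ex[of d] unfolding mem_Collect_eq by blast
    then show "tensor_real_class G d \<in> range (\<lambda>c. tensor_real_class G (tensor_comb c))"
      by simp
  qed (use keys_tensor_comb in simp)
qed

text \<open>The combinations of class zero form a subspace \<open>K\<close> that misses
  \<open>w\<close>. A basis of \<open>K\<close> together with \<open>w\<close> is independent, so
  some functional is 0 on \<open>K\<close> and 1 at \<open>w\<close>; it descends to
  classes.\<close>

lemma real_functional_separates_zero:
  assumes w: "tensor_real_class G (tensor_comb w) \<noteq> tensor_real_class G 0"
  obtains \<phi> :: "_ \<Rightarrow> real" where "real_linear_on (tensor_real G) \<phi>"
    and "\<phi> (tensor_real_class G (tensor_comb w)) = 1"
proof -
  interpret P: vector_space_pair comb_scale "(*) :: real \<Rightarrow> real \<Rightarrow> real"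
    by (intro vector_space_pair.intro comb_vector_space) (unfold_locales, auto simp: algebra_simps)
  define K where "K = {c. tensor_comb c \<in> tensor_real_relations G}"
  have class_eq: "tensor_real_class G (tensor_comb c) = tensor_real_class G (tensor_comb d) \<longleftrightarrow> c - d \<in> K" for c d
  proof -
    have "tensor_comb (c - d + d) - (tensor_comb (c - d) + tensor_comb d) \<in> tensor_real_relations G"
      using tensor_comb_add[of "c - d" d] unfolding tensor_real_class_eq_iff .
    then have *: "tensor_comb c - (tensor_comb (c - d) + tensor_comb d) \<in> tensor_real_relations G"
      by simp
    show ?thesis
      unfolding K_def tensor_real_class_eq_iff mem_Collect_eq
      using tensor_real_relations_add[OF *, of "tensor_comb (c - d)"]
        tensor_real_relations_diff[OF _ *, of "tensor_comb c - tensor_comb d"]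
      by auto
  qed
  have K0: "c \<in> K \<longleftrightarrow> tensor_real_class G (tensor_comb c) = tensor_real_class G 0" for c
    by (simp add: K_def tensor_real_class_eq_iff)
  have K: "P.vs1.subspace K"
  proof (rule P.vs1.subspaceI)
    show "0 \<in> K"
      by (simp add: K0 tensor_comb_def)
    show "x + y \<in> K" if "x \<in> K" "y \<in> K" for x y
      using that tensor_real_relations_add
      unfolding K0 tensor_comb_add by (simp add: tensor_real_class_eq_iff)
    show "comb_scale r x \<in> K" if "x \<in> K" for r x
      using that tensor_scale_relations unfolding K0 tensor_comb_scale by (simp add: tensor_real_class_eq_iff)
  qed
  obtain B where B: "B \<subseteq> K" "P.vs1.independent B" "K \<subseteq> P.vs1.span B"
    using P.vs1.maximal_independent_subset by blast
  have span: "P.vs1.span B = K"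
    using B K P.vs1.span_minimal by blast
  have "w \<notin> P.vs1.span B"
    using w unfolding span K0 by simp
  then have "P.vs1.independent (insert w B)"
    using B(2) by (rule P.vs1.independent_insertI)
  then obtain g where g: "Vector_Spaces.linear comb_scale (*) g"
    "\<forall>x\<in>insert w B. g x = (if x = w then 1 else (0::real))"
    using P.linear_independent_extend[where f = "\<lambda>x. if x = w then 1 else 0"] by blast
  interpret g: Vector_Spaces.linear comb_scale "(*)" g
    by (rule g(1))
  have gK: "g c = 0" if "c \<in> K" for c
  proof (rule g.eq_0_on_span)
    show "c \<in> P.vs1.span B"
      using that span by simp
    show "g b = 0" if "b \<in> B" for b
      using g(2) that \<open>w \<notin> P.vs1.span B\<close> P.vs1.span_base by auto
  qed
  \<comment> \<open>Two combinations of the same class differ by an element of \<open>K\<close>,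
    where \<open>g\<close> vanishes.\<close>
  define \<phi> where "\<phi> X = g (SOME c. tensor_real_class G (tensor_comb c) = X)" for X
  have \<phi>: "\<phi> (tensor_real_class G (tensor_comb c)) = g c" for c
  proof -
    have "tensor_real_class G (tensor_comb (SOME d. tensor_real_class G (tensor_comb d) = tensor_real_class G (tensor_comb c)))
        = tensor_real_class G (tensor_comb c)"
      by (rule someI[of _ c]) simp
    then have "g ((SOME d. tensor_real_class G (tensor_comb d) = tensor_real_class G (tensor_comb c)) - c) = 0"
      unfolding class_eq by (rule gK)
    then show ?thesis
      unfolding \<phi>_def g.diff by simp
  qed
  show ?thesis
  proof (rule that[of \<phi>])
    show "real_linear_on (tensor_real G) \<phi>"
      unfolding real_linear_on_def carrier_tensor_real_comb
      by (safe; simp only: add_tensor_real smult_tensor_real tensor_comb_add[symmetric]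
          tensor_comb_scale[symmetric] \<phi> g.add g.scale real_scaleR_def)
  qed (use \<phi> g(2) in simp)
qed

text \<open>This makes limits in the linear topology unique, as the definite description in
  \<open>ab_drift\<close> demands.\<close>

lemma real_functionals_separate:
  assumes uv: "u \<in> carrier (tensor_real G)" "v \<in> carrier (tensor_real G)"
    and eq: "\<And>\<phi> :: _ \<Rightarrow> real. real_linear_on (tensor_real G) \<phi> \<Longrightarrow> \<phi> u = \<phi> v"
  shows "u = v"
proof (rule ccontr)
  assume "u \<noteq> v"
  obtain c d where cd: "u = tensor_real_class G (tensor_comb c)" "v = tensor_real_class G (tensor_comb d)"
    using uv by (auto simp: carrier_tensor_real_comb)
  have u: "u = tensor_real_class G (tensor_comb (c - d)) \<oplus>\<^bsub>tensor_real G\<^esub> v"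
    using tensor_comb_add[of "c - d" d] by (simp add: cd add_tensor_real)
  have "tensor_real_class G (tensor_comb (c - d)) \<noteq> tensor_real_class G 0"
  proof
    assume "tensor_real_class G (tensor_comb (c - d)) = tensor_real_class G 0"
    then have "u = tensor_real_class G 0 \<oplus>\<^bsub>tensor_real G\<^esub> v"
      using u by simp
    then show False
      using \<open>u \<noteq> v\<close> by (simp add: cd add_tensor_real)
  qed
  then obtain \<phi> :: "_ \<Rightarrow> real" where \<phi>: "real_linear_on (tensor_real G) \<phi>"
    "\<phi> (tensor_real_class G (tensor_comb (c - d))) = 1"
    by (rule real_functional_separates_zero)
  have "\<phi> u = \<phi> (tensor_real_class G (tensor_comb (c - d))) + \<phi> v"
    unfolding u using \<phi>(1) uv(2) unfolding real_linear_on_def carrier_tensor_real_comb by blast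
  then show False
    using eq[OF \<phi>(1)] \<phi>(2) by simp
qed

end

section \<open>The linear topology\<close>

lemma topspace_linear_topology: "topspace (linear_topology V) = carrier V"
proof -
  have "\<exists>(\<phi> :: _ \<Rightarrow> real) U. carrier V = {v \<in> carrier V. \<phi> v \<in> U} \<and> real_linear_on V \<phi> \<and> open U"
    \<comment> \<open>The zero functional exhibits the whole carrier as a basic open set.\<close>
    by (intro exI[of _ "\<lambda>_. 0"] exI[of _ UNIV]) (simp add: real_linear_on_def)
  then show ?thesis
    unfolding linear_topology_def topology_generated_by_topspace by blast
qed

lemma continuous_map_real_functional:
  fixes \<phi> :: "_ \<Rightarrow> real"
  assumes "real_linear_on V \<phi>"
  shows "continuous_map (linear_topology V) euclidean \<phi>"
  unfolding continuous_map_def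
proof (intro conjI allI impI)
  fix U :: "real set" assume "openin euclidean U"
  then have "open U"
    by simp
  then show "openin (linear_topology V) {v \<in> topspace (linear_topology V). \<phi> v \<in> U}"
    unfolding topspace_linear_topology unfolding linear_topology_def
    using assms by (intro topology_generated_by_Basis) blast
qed simp

text \<open>The topology is initial for the real functionals, so convergence can be tested on real
  numbers. The converse direction is an induction over the generation of open sets.\<close>

lemma limitin_linear_topology_iff:
  "limitin (linear_topology V) f m F \<longleftrightarrow>
     m \<in> carrier V \<and> (\<forall>\<^sub>F x in F. f x \<in> carrier V) \<and>
     (\<forall>\<phi> :: _ \<Rightarrow> real. real_linear_on V \<phi> \<longrightarrow> ((\<lambda>x. \<phi> (f x)) \<longlongrightarrow> \<phi> m) F)"
  (is "?lhs \<longleftrightarrow> ?rhs")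
proof
  assume lim: ?lhs
  have "((\<lambda>x. \<phi> (f x)) \<longlongrightarrow> \<phi> m) F" if "real_linear_on V \<phi>" for \<phi> :: "_ \<Rightarrow> real"
    using continuous_map_limit[OF continuous_map_real_functional[OF that] lim]
    by (simp add: limitin_canonical_iff o_def)
  moreover have "\<forall>\<^sub>F x in F. f x \<in> carrier V"
    using lim unfolding limitin_def topspace_linear_topology
    by (metis openin_topspace topspace_linear_topology)
  ultimately show ?rhs
    using lim limitin_topspace topspace_linear_topology by metis
next
  assume R: ?rhs
  have "\<forall>\<^sub>F x in F. f x \<in> U" if "openin (linear_topology V) U" "m \<in> U" for U
  proof -
    have "generate_topology_on {{v \<in> carrier V. \<phi> v \<in> U} | (\<phi> :: _ \<Rightarrow> real) U. real_linear_on V \<phi> \<and> open U} U"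
      using that(1) unfolding linear_topology_def by (rule openin_topology_generated_by)
    then show ?thesis
      using that(2)
    proof induction
      case (Basis s)
      then obtain \<phi> :: "_ \<Rightarrow> real" and W where W: "s = {v \<in> carrier V. \<phi> v \<in> W}" "real_linear_on V \<phi>" "open W"
        by blast
      then have "\<forall>\<^sub>F x in F. \<phi> (f x) \<in> W"
        using R Basis(2) by (auto intro: topological_tendstoD)
      then show ?case
        using R W(1) by (auto elim: eventually_elim2)
    next
      case (UN K)
      then obtain k where "k \<in> K" "m \<in> k" by blast
      then have "\<forall>\<^sub>F x in F. f x \<in> k"
        using UN.IH by blast
      then show ?case
        by (rule eventually_mono) (use \<open>k \<in> K\<close> in blast)
    qed (auto intro: eventually_conj)
  qed
  then show ?lhs
    using R by (simp add: limitin_def topspace_linear_topology)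
qed

text \<open>Coordinates of \<open>L v\<close> in a finite basis are real functionals of
  \<open>v\<close>, hence continuous by the choice of the topology, and \<open>L\<close> is a finite
  sum of coordinates times fixed vectors.\<close>

lemma finite_rank_bounded_real_linear_on:
  fixes L :: "_ \<Rightarrow> 'e::real_normed_vector"
  assumes L: "real_linear_on V L" and T: "finite T" "\<And>v. v \<in> carrier V \<Longrightarrow> L v \<in> span T"
  shows "bounded_real_linear_on V L"
proof -
  obtain B where B: "B \<subseteq> T" "independent B" "T \<subseteq> span B"
    using maximal_independent_subset by blast
  have fin: "finite B"
    using B(1) T(1) by (rule finite_subset)
  have "span T \<subseteq> span B"
    using B(3) by (rule span_minimal) (rule subspace_span)
  then have LB: "L v \<in> span B" if "v \<in> carrier V" for v
    using T(2) that by blast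
  have "real_linear_on V (\<lambda>v. representation B (L v) b)" for b
    using L LB unfolding real_linear_on_def
    by (simp add: representation_add[OF B(2)] representation_scale[OF B(2)])
  then have "continuous_map (linear_topology V) euclidean (\<lambda>v. representation B (L v) b)" for b
    by (rule continuous_map_real_functional)
  moreover have "continuous_map euclidean euclidean (\<lambda>t. t *\<^sub>R b)" for b :: 'e
    by (simp add: continuous_intros)
  ultimately have "continuous_map (linear_topology V) euclidean (\<lambda>v. representation B (L v) b *\<^sub>R b)" for b
    using continuous_map_compose[of "linear_topology V" euclidean "\<lambda>v. representation B (L v) b" euclidean "\<lambda>t. t *\<^sub>R b"]
    by (simp add: o_def)
  then have "continuous_map (linear_topology V) euclidean (\<lambda>v. \<Sum>b\<in>B. representation B (L v) b *\<^sub>R b)"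
    by (intro continuous_map_sum fin)
  moreover have "(\<Sum>b\<in>B. representation B (L v) b *\<^sub>R b) = L v" if "v \<in> topspace (linear_topology V)" for v
    using sum_representation_eq[OF B(2) LB fin] that by (simp add: topspace_linear_topology)
  ultimately have "continuous_map (linear_topology V) euclidean L"
    by (rule continuous_map_eq)
  then show ?thesis
    using L by (simp add: bounded_real_linear_on_def)
qed

section \<open>Abelian drift\<close>

context group
begin

section \<open>Words in the generators and expected letter counts\<close>

lemma foldr_mult_closed: "set w \<subseteq> carrier G \<Longrightarrow> foldr (\<otimes>) w \<one> \<in> carrier G"
  by (induction w) auto

lemma foldr_mult_append:
  "set u \<subseteq> carrier G \<Longrightarrow> set w \<subseteq> carrier G \<Longrightarrow>
     foldr (\<otimes>) (u @ w) \<one> = foldr (\<otimes>) u \<one> \<otimes> foldr (\<otimes>) w \<one>"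
  by (induction u) (auto simp: m_assoc foldr_mult_closed simp del: foldr_append)

text \<open>A chosen geodesic word. Its letter counts are at most \<open>word_length\<close>, and
  they determine the value of every additive map at \<open>x\<close>.\<close>

definition reduced_word :: "'a set \<Rightarrow> 'a \<Rightarrow> 'a list" where
  "reduced_word S x =
     (SOME w. length w = word_length G S x \<and> set w \<subseteq> S \<and> foldr (\<otimes>) w \<one> = x)"

lemma reduced_word:
  assumes S: "symmetric_generating_set G S" and x: "x \<in> carrier G"
  shows "length (reduced_word S x) = word_length G S x" "set (reduced_word S x) \<subseteq> S"
    "foldr (\<otimes>) (reduced_word S x) \<one> = x"
proof -
  have S': "S \<subseteq> carrier G" "\<And>s. s \<in> S \<Longrightarrow> inv s \<in> S" "generate G S = carrier G"
    using S unfolding symmetric_generating_set_def by auto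
  have "x \<in> generate G S"
    using x S' by simp
  then have "\<exists>w. set w \<subseteq> S \<and> foldr (\<otimes>) w \<one> = x"
  proof induction
    case one
    show ?case by (rule exI[of _ "[]"]) simp
  next
    case (incl s)
    then show ?case using S' by (intro exI[of _ "[s]"]) auto
  next
    case (inv s)
    \<comment> \<open>Symmetry of \<open>S\<close> makes the inverse a letter.\<close>
    then show ?case using S' by (intro exI[of _ "[inv s]"]) auto
  next
    case (eng g h)
    then obtain u w where "set u \<subseteq> S" "foldr (\<otimes>) u \<one> = g" "set w \<subseteq> S" "foldr (\<otimes>) w \<one> = h"
      by blast
    then show ?case
      using foldr_mult_append[of u w] S'(1) by (intro exI[of _ "u @ w"]) (auto simp del: foldr_append)
  qed
  then have "\<exists>n w. length w = n \<and> set w \<subseteq> S \<and> foldr (\<otimes>) w \<one> = x"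
    by blast
  then have "\<exists>w. length w = word_length G S x \<and> set w \<subseteq> S \<and> foldr (\<otimes>) w \<one> = x"
    unfolding word_length_def by (rule LeastI_ex)
  from someI_ex[OF this] show "length (reduced_word S x) = word_length G S x" "set (reduced_word S x) \<subseteq> S"
    "foldr (\<otimes>) (reduced_word S x) \<one> = x"
    unfolding reduced_word_def by blast+
qed

lemma additive_foldr_mult:
  fixes l :: "'a \<Rightarrow> 'e::real_vector"
  assumes l: "\<And>a b. a \<in> carrier G \<Longrightarrow> b \<in> carrier G \<Longrightarrow> l (a \<otimes> b) = l a + l b"
    and S: "finite S" "S \<subseteq> carrier G" and w: "set w \<subseteq> S"
  shows "l (foldr (\<otimes>) w \<one>) = (\<Sum>s\<in>S. real (count_list w s) *\<^sub>R l s)"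
  using w
proof (induction w)
  case Nil
  show ?case using l[of \<one> \<one>] by simp
next
  case (Cons a w)
  have "l (foldr (\<otimes>) (a # w) \<one>) = l a + l (foldr (\<otimes>) w \<one>)"
    using Cons.prems S foldr_mult_closed[of w] by (auto intro!: l)
  also have "\<dots> = (\<Sum>s\<in>S. if s = a then l s else 0) + (\<Sum>s\<in>S. real (count_list w s) *\<^sub>R l s)"
    using Cons S(1) by simp
  also have "\<dots> = (\<Sum>s\<in>S. real (count_list (a # w) s) *\<^sub>R l s)"
    unfolding sum.distrib[symmetric] by (intro sum.cong) (auto simp: scaleR_left_distrib)
  finally show ?case .
qed

text \<open>The expected number of letters \<open>s\<close> in the chosen word of a random element
  with law \<mu>. It depends on the chosen words; the resulting drift does not.\<close>

definition drift_coeff :: "'a set \<Rightarrow> 'a pmf \<Rightarrow> 'a \<Rightarrow> real" where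
  "drift_coeff S \<mu> s = (\<Sum>\<^sub>\<infinity>x\<in>carrier G. pmf \<mu> x * real (count_list (reduced_word S x) s))"

text \<open>The exponential moment controls the first moment: a letter count is at most the word
  length \<open>n\<close>, and \<open>n \<le> exp (\<zeta> * n) / \<zeta>\<close>.\<close>

lemma drift_coeff_has_sum:
  assumes S: "symmetric_generating_set G S" and mu: "smooth_measure G S \<mu>"
  shows "((\<lambda>x. pmf \<mu> x * real (count_list (reduced_word S x) s)) has_sum drift_coeff S \<mu> s) (carrier G)"
proof -
  obtain \<zeta> where \<zeta>: "\<zeta> > 0"
    "(\<lambda>x. pmf \<mu> x * exp (\<zeta> * real (word_length G S x))) summable_on carrier G"
    using mu unfolding smooth_measure_def by blast
  have "(\<lambda>x. norm (pmf \<mu> x * real (count_list (reduced_word S x) s))) summable_on carrier G"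
  proof (rule Infinite_Sum.abs_summable_on_comparison_test')
    show "(\<lambda>x. pmf \<mu> x * exp (\<zeta> * real (word_length G S x)) * (1 / \<zeta>)) summable_on carrier G"
      using \<zeta>(2) by (rule summable_on_cmult_left)
    fix x assume x: "x \<in> carrier G"
    have "\<zeta> * real (count_list (reduced_word S x) s) \<le> \<zeta> * real (word_length G S x)"
      using count_le_length[of "reduced_word S x" s] reduced_word(1)[OF S x] \<zeta>(1) by simp
    also have "\<dots> \<le> exp (\<zeta> * real (word_length G S x))"
      using exp_ge_add_one_self[of "\<zeta> * real (word_length G S x)"] by linarith
    finally have "real (count_list (reduced_word S x) s) \<le> exp (\<zeta> * real (word_length G S x)) * (1 / \<zeta>)"
      using \<zeta>(1) by (simp add: pos_le_divide_eq mult.commute)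
    then have "pmf \<mu> x * real (count_list (reduced_word S x) s) \<le> pmf \<mu> x * (exp (\<zeta> * real (word_length G S x)) * (1 / \<zeta>))"
      by (rule mult_left_mono) simp
    then show "norm (pmf \<mu> x * real (count_list (reduced_word S x) s)) \<le> pmf \<mu> x * exp (\<zeta> * real (word_length G S x)) * (1 / \<zeta>)"
      by (simp add: mult.assoc)
  qed
  then have "(\<lambda>x. pmf \<mu> x * real (count_list (reduced_word S x) s)) summable_on carrier G"
    by (rule abs_summable_summable)
  then show ?thesis
    unfolding drift_coeff_def by (rule has_sum_infsum)
qed

text \<open>Expanding \<open>l x\<close> by letter counts turns a series of vectors into finitely
  many real series, one for each generator.\<close>

lemma additive_drift_has_sum:
  fixes l :: "'a \<Rightarrow> 'e::real_normed_vector"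
  assumes l: "\<And>a b. a \<in> carrier G \<Longrightarrow> b \<in> carrier G \<Longrightarrow> l (a \<otimes> b) = l a + l b"
    and S: "finite S" "symmetric_generating_set G S" and mu: "smooth_measure G S \<mu>"
  shows "((\<lambda>x. pmf \<mu> x *\<^sub>R l x) has_sum (\<Sum>s\<in>S. drift_coeff S \<mu> s *\<^sub>R l s)) (carrier G)"
proof -
  have SG: "S \<subseteq> carrier G"
    using S(2) by (simp add: symmetric_generating_set_def)
  have "((\<lambda>x. \<Sum>s\<in>T. (pmf \<mu> x * real (count_list (reduced_word S x) s)) *\<^sub>R l s) has_sum
      (\<Sum>s\<in>T. drift_coeff S \<mu> s *\<^sub>R l s)) (carrier G)" if "finite T" for T
    using that
  proof induction
    case (insert t T)
    have "((\<lambda>x. (pmf \<mu> x * real (count_list (reduced_word S x) t)) *\<^sub>R l t) has_sum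
        drift_coeff S \<mu> t *\<^sub>R l t) (carrier G)"
      by (rule has_sum_bounded_linear[OF bounded_linear_scaleR_left drift_coeff_has_sum[OF S(2) mu]])
    then show ?case
      using has_sum_add[OF _ insert.IH] insert.hyps by simp
  qed simp
  from this[OF S(1)] show ?thesis
  proof (rule has_sum_cong[THEN iffD1, rotated])
    fix x assume x: "x \<in> carrier G"
    have "l x = (\<Sum>s\<in>S. real (count_list (reduced_word S x) s) *\<^sub>R l s)"
      using additive_foldr_mult[where l = l, OF l S(1) SG reduced_word(2)[OF S(2) x]] reduced_word(3)[OF S(2) x] by simp
    then show "(\<Sum>s\<in>S. (pmf \<mu> x * real (count_list (reduced_word S x) s)) *\<^sub>R l s) = pmf \<mu> x *\<^sub>R l x"
      by (simp add: scaleR_sum_right)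
  qed
qed

section \<open>The image of the group in its real abelianization\<close>

lemma abelianization_comm_group: "comm_group (abelianization G)"
  unfolding abelianization_def by (rule derived_quot_is_comm_group)

lemma abelianization_coset_closed:
  "x \<in> carrier G \<Longrightarrow> derived G (carrier G) #> x \<in> carrier (abelianization G)"
  by (auto simp: abelianization_def FactGroup_def RCOSETS_def)

lemma abelianization_coset_mult:
  assumes "x \<in> carrier G" "y \<in> carrier G"
  shows "derived G (carrier G) #> (x \<otimes> y) =
    (derived G (carrier G) #> x) \<otimes>\<^bsub>abelianization G\<^esub> (derived G (carrier G) #> y)"
  using normal.rcos_sum[OF derived_self_is_normal assms]
  by (simp add: abelianization_def FactGroup_def)

lemma ab_image_closed: "x \<in> carrier G \<Longrightarrow> ab_image G x \<in> carrier (real_abelianization G)"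
  unfolding ab_image_def
  by (rule group.pure_tensor_closed[OF comm_group.axioms(2)[OF abelianization_comm_group]
        abelianization_coset_closed])

lemma ab_image_mult:
  assumes "x \<in> carrier G" "y \<in> carrier G"
  shows "ab_image G (x \<otimes> y) = ab_image G x \<oplus>\<^bsub>real_abelianization G\<^esub> ab_image G y"
  unfolding ab_image_def abelianization_coset_mult[OF assms]
  using assms by (intro group.pure_tensor_mult comm_group.axioms(2) abelianization_comm_group
      abelianization_coset_closed)

end

lemma real_linear_on_zero:
  assumes "abelian_monoid V" "real_linear_on V L"
  shows "L \<zero>\<^bsub>V\<^esub> = 0"
proof -
  interpret abelian_monoid V by fact
  have "L (\<zero>\<^bsub>V\<^esub> \<oplus>\<^bsub>V\<^esub> \<zero>\<^bsub>V\<^esub>) = L \<zero>\<^bsub>V\<^esub> + L \<zero>\<^bsub>V\<^esub>"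
    using assms(2) unfolding real_linear_on_def by blast
  then show ?thesis by simp
qed

lemma real_linear_on_finsum:
  assumes "abelian_monoid V" "real_linear_on V L" and "finite F" "\<And>x. x \<in> F \<Longrightarrow> f x \<in> carrier V"
  shows "L (finsum V f F) = (\<Sum>x\<in>F. L (f x))"
proof -
  interpret abelian_monoid V by fact
  show ?thesis
    using assms(3,4)
  proof induction
    case empty
    show ?case using real_linear_on_zero[OF assms(1,2)] by simp
  next
    case (insert x F)
    then have "f x \<in> carrier V" "finsum V f F \<in> carrier V" "f \<in> F \<rightarrow> carrier V"
      by (auto intro: finsum_closed)
    with insert show ?case
      using assms(2) unfolding real_linear_on_def by simp
  qed
qed

context group
begin

text \<open>The candidate for the limit that defines the drift, as a finite sum over the
  generators.\<close>

definition drift_vector :: "'a set \<Rightarrow> 'a pmf \<Rightarrow> ('a set \<times> real \<Rightarrow>\<^sub>0 int) set" where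
  "drift_vector S \<mu> = finsum (real_abelianization G)
     (\<lambda>s. drift_coeff S \<mu> s \<odot>\<^bsub>real_abelianization G\<^esub> ab_image G s) S"

lemma abelian_monoid_real_abelianization: "abelian_monoid (real_abelianization G)"
  by (intro group.abelian_monoid_tensor_real comm_group.axioms(2) abelianization_comm_group)

lemma smult_ab_image_closed:
  "x \<in> carrier G \<Longrightarrow> r \<odot>\<^bsub>real_abelianization G\<^esub> ab_image G x \<in> carrier (real_abelianization G)"
  unfolding ab_image_def
  by (simp add: group.smult_pure_tensor group.pure_tensor_closed abelianization_coset_closed
      comm_group.axioms(2)[OF abelianization_comm_group])

lemma real_linear_on_smult_ab_image_finsum:
  assumes "real_linear_on (real_abelianization G) L" and "finite F" "F \<subseteq> carrier G"
  shows "L (finsum (real_abelianization G) (\<lambda>x. r x \<odot>\<^bsub>real_abelianization G\<^esub> ab_image G x) F) =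
    (\<Sum>x\<in>F. r x *\<^sub>R L (ab_image G x))"
proof -
  have "L (r x \<odot>\<^bsub>real_abelianization G\<^esub> ab_image G x) = r x *\<^sub>R L (ab_image G x)" if "x \<in> F" for x
    using assms that ab_image_closed unfolding real_linear_on_def by blast
  then show ?thesis
    using assms smult_ab_image_closed
    by (subst real_linear_on_finsum[OF abelian_monoid_real_abelianization]) auto
qed

lemma finsum_ab_image_closed:
  "F \<subseteq> carrier G \<Longrightarrow>
    finsum (real_abelianization G) (\<lambda>x. r x \<odot>\<^bsub>real_abelianization G\<^esub> ab_image G x) F
      \<in> carrier (real_abelianization G)"
  using smult_ab_image_closed
  by (intro abelian_monoid.finsum_closed[OF abelian_monoid_real_abelianization]) auto

text \<open>Linearity alone carries \<open>L\<close> through the infinite series, which reduces to a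
  finite sum over \<open>S\<close>. Real functionals \<open>L\<close> identify the drift; later
  \<open>L\<close> is \<Lambda> itself.\<close>

lemma drift_vector_has_sum:
  fixes L :: "_ \<Rightarrow> 'e::real_normed_vector"
  assumes L: "real_linear_on (real_abelianization G) L"
    and S: "finite S" "symmetric_generating_set G S" and mu: "smooth_measure G S \<mu>"
  shows "((\<lambda>x. pmf \<mu> x *\<^sub>R L (ab_image G x)) has_sum L (drift_vector S \<mu>)) (carrier G)"
proof -
  have "L (drift_vector S \<mu>) = (\<Sum>s\<in>S. drift_coeff S \<mu> s *\<^sub>R L (ab_image G s))"
    unfolding drift_vector_def
    using S by (intro real_linear_on_smult_ab_image_finsum L) (auto simp: symmetric_generating_set_def)
  moreover have "L (ab_image G (a \<otimes> b)) = L (ab_image G a) + L (ab_image G b)"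
    if "a \<in> carrier G" "b \<in> carrier G" for a b
    using L that ab_image_closed unfolding real_linear_on_def by (simp add: ab_image_mult)
  ultimately show ?thesis
    using additive_drift_has_sum[of "\<lambda>x. L (ab_image G x)", OF _ S mu] by simp
qed

text \<open>Convergence is checked on each real functional; any other limit agrees on all of them
  and is therefore equal.\<close>

lemma ab_drift_eq_drift_vector:
  assumes S: "finite S" "symmetric_generating_set G S" and mu: "smooth_measure G S \<mu>"
  shows "ab_drift G \<mu> = drift_vector S \<mu>"
proof -
  let ?V = "real_abelianization G"
  let ?s = "\<lambda>F. finsum ?V (\<lambda>g. pmf \<mu> g \<odot>\<^bsub>?V\<^esub> ab_image G g) F"
  let ?F = "finite_subsets_at_top (carrier G)"
  have closed: "drift_vector S \<mu> \<in> carrier ?V"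
    unfolding drift_vector_def
    using S(2) by (intro finsum_ab_image_closed) (auto simp: symmetric_generating_set_def)
  have tends: "((\<lambda>F. \<phi> (?s F)) \<longlongrightarrow> \<phi> (drift_vector S \<mu>)) ?F"
    if \<phi>: "real_linear_on ?V \<phi>" for \<phi> :: "_ \<Rightarrow> real"
  proof -
    have "(sum (\<lambda>x. pmf \<mu> x *\<^sub>R \<phi> (ab_image G x)) \<longlongrightarrow> \<phi> (drift_vector S \<mu>)) ?F"
      using drift_vector_has_sum[OF \<phi> S mu] unfolding has_sum_def .
    moreover have "\<forall>\<^sub>F F in ?F. sum (\<lambda>x. pmf \<mu> x *\<^sub>R \<phi> (ab_image G x)) F = \<phi> (?s F)"
      by (rule eventually_finite_subsets_at_top_weakI)
        (simp add: real_linear_on_smult_ab_image_finsum[OF \<phi>])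
    ultimately show ?thesis
      by (rule Lim_transform_eventually)
  qed
  have "limitin (linear_topology ?V) ?s (drift_vector S \<mu>) ?F"
    unfolding limitin_linear_topology_iff
    using closed tends by (auto intro: eventually_finite_subsets_at_top_weakI finsum_ab_image_closed)
  moreover have "m = drift_vector S \<mu>" if "limitin (linear_topology ?V) ?s m ?F" for m
  proof (rule group.real_functionals_separate)
    show "group (abelianization G)"
      by (intro comm_group.axioms(2) abelianization_comm_group)
    show "m \<in> carrier ?V"
      using that by (simp add: limitin_linear_topology_iff)
    fix \<phi> :: "_ \<Rightarrow> real" assume \<phi>: "real_linear_on ?V \<phi>"
    then have "((\<lambda>F. \<phi> (?s F)) \<longlongrightarrow> \<phi> m) ?F"
      using that by (simp add: limitin_linear_topology_iff)
    then show "\<phi> m = \<phi> (drift_vector S \<mu>)"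
      using tends[OF \<phi>] by (rule tendsto_unique[OF finite_subsets_at_top_neq_bot])
  qed (rule closed)
  ultimately show ?thesis
    unfolding ab_drift_def by (rule the_equality)
qed

section \<open>Factoring additive maps through the abelianization\<close>

lemma additive_derived_zero:
  fixes l :: "'a \<Rightarrow> 'e::real_vector"
  assumes l: "\<And>a b. a \<in> carrier G \<Longrightarrow> b \<in> carrier G \<Longrightarrow> l (a \<otimes> b) = l a + l b"
    and x: "x \<in> derived G (carrier G)"
  shows "l x = 0"
proof -
  have one: "l \<one> = 0"
    using l[of \<one> \<one>] by simp
  have inv: "l (inv a) = - l a" if "a \<in> carrier G" for a
    using l[of a "inv a"] that one by (simp add: eq_neg_iff_add_eq_0 add.commute)
  have "x \<in> carrier G \<and> l x = 0"
    using x unfolding derived_def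
  proof induction
    case one
    show ?case using \<open>l \<one> = 0\<close> by simp
  next
    case (inv h)
    then show ?case using l \<open>\<And>a. a \<in> carrier G \<Longrightarrow> l (inv a) = - l a\<close> by auto
  qed (auto simp: l inv)
  then show ?thesis by simp
qed

text \<open>The map first passes to cosets of the derived subgroup and then to the tensor product.
  The span condition is recorded for the finite-rank argument behind boundedness.\<close>

lemma additive_real_abelianization_lift:
  fixes l :: "'a \<Rightarrow> 'e::real_vector"
  assumes l: "\<And>a b. a \<in> carrier G \<Longrightarrow> b \<in> carrier G \<Longrightarrow> l (a \<otimes> b) = l a + l b"
  obtains L where "real_linear_on (real_abelianization G) L"
    and "\<forall>x\<in>carrier G. L (ab_image G x) = l x"
    and "\<forall>v\<in>carrier (real_abelianization G). L v \<in> span (l ` carrier G)"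
proof -
  let ?D = "derived G (carrier G)"
  interpret A: comm_group "abelianization G"
    by (rule abelianization_comm_group)
  have D: "?D \<subseteq> carrier G"
    by (simp add: derived_in_carrier)
  \<comment> \<open>Elements of one coset differ by a factor in the derived subgroup, where
    \<open>l\<close> vanishes.\<close>
  define k where "k X = l (SOME x. x \<in> X)" for X
  have k: "k (?D #> x) = l x" if x: "x \<in> carrier G" for x
  proof -
    have "x \<in> ?D #> x"
      using x by (intro rcos_self derived_is_subgroup) simp_all
    then have "(SOME y. y \<in> ?D #> x) \<in> ?D #> x"
      by (rule someI)
    then obtain d where "d \<in> ?D" "(SOME y. y \<in> ?D #> x) = d \<otimes> x"
      by (auto simp: r_coset_def)
    then show ?thesis
      unfolding k_def using l[of d x] D x additive_derived_zero[where l = l, OF l] by auto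
  qed
  have cosets: "\<exists>x\<in>carrier G. X = ?D #> x" if "X \<in> carrier (abelianization G)" for X
    using that by (auto simp: abelianization_def FactGroup_def RCOSETS_def)
  have kmult: "k (X \<otimes>\<^bsub>abelianization G\<^esub> Y) = k X + k Y"
    if XY: "X \<in> carrier (abelianization G)" "Y \<in> carrier (abelianization G)" for X Y
  proof -
    obtain x y where "x \<in> carrier G" "X = ?D #> x" "y \<in> carrier G" "Y = ?D #> y"
      using cosets[OF XY(1)] cosets[OF XY(2)] by blast
    then show ?thesis
      using k l by (simp flip: abelianization_coset_mult)
  qed
  obtain L where L: "real_linear_on (real_abelianization G) L"
    "\<forall>a\<in>carrier (abelianization G). \<forall>t. L (pure_tensor (abelianization G) a t) = t *\<^sub>R k a"
    by (rule A.tensor_real_lift[where l = k, OF kmult])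
  show ?thesis
  proof (rule that[OF L(1)])
    show "\<forall>x\<in>carrier G. L (ab_image G x) = l x"
      by (simp add: ab_image_def L(2) abelianization_coset_closed k)
    have "L (tensor_real_class (abelianization G) c) \<in> span (l ` carrier G)"
      if "Poly_Mapping.keys c \<subseteq> carrier (abelianization G) \<times> UNIV" for c
      using that
    proof (induction rule: frag_keys_induct)
      case zero
      have "L (tensor_real_class (abelianization G) 0) = 0"
        using real_linear_on_zero[OF A.abelian_monoid_tensor_real L(1)] by (simp add: A.zero_tensor_real)
      then show ?case by (simp add: span_zero)
    next
      case (diff x y)
      \<comment> \<open>Linearity is stated for sums, so the value at a difference is read off from
        \<open>x = (x - y) + y\<close>.\<close>
      have "tensor_real_class (abelianization G) x =
          tensor_real_class (abelianization G) (x - y) \<oplus>\<^bsub>real_abelianization G\<^esub> tensor_real_class (abelianization G) y"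
        by (simp add: A.add_tensor_real)
      moreover have "tensor_real_class (abelianization G) (x - y) \<in> carrier (real_abelianization G)"
        "tensor_real_class (abelianization G) y \<in> carrier (real_abelianization G)"
        using diff keys_diff[of x y] by (auto simp: A.carrier_tensor_real)
      ultimately have "L (tensor_real_class (abelianization G) x) =
          L (tensor_real_class (abelianization G) (x - y)) + L (tensor_real_class (abelianization G) y)"
        using L(1) unfolding real_linear_on_def by metis
      then have "L (tensor_real_class (abelianization G) (x - y)) =
          L (tensor_real_class (abelianization G) x) - L (tensor_real_class (abelianization G) y)"
        by simp
      then show ?case
        using diff by (simp add: span_diff)
    next
      case (gen p)
      then obtain x t where "p = (?D #> x, t)" "x \<in> carrier G"
        using cosets by (cases p) auto
      then show ?case
        using L(2) k abelianization_coset_closed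
        by (simp add: pure_tensor_def span_scale span_base)
    qed
    then show "\<forall>v\<in>carrier (real_abelianization G). L v \<in> span (l ` carrier G)"
      by (auto simp: A.carrier_tensor_real)
  qed
qed

lemma lipschitz_harmonic_affine:
  fixes f :: "'a \<Rightarrow> 'e::banach"
  assumes nil: "lower_central_series G k = {\<one>}"
    and S: "finite S" "symmetric_generating_set G S"
    and mu: "set_pmf \<mu> \<subseteq> carrier G" "adapted G \<mu>" "smooth_measure G S \<mu>"
    and f: "lipschitz_map G S f" "harmonic_map G \<mu> f"
  obtains \<Lambda> where "bounded_real_linear_on (real_abelianization G) \<Lambda>"
    and "\<Lambda> (ab_drift G \<mu>) = 0"
    and "\<forall>x\<in>carrier G. f x = f \<one> + \<Lambda> (ab_image G x)"
proof -
  define l where "l x = f x - f \<one>" for x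
  have mean: "mean_value G \<mu> f"
    using f(2) by (rule harmonic_map_mean_value)
  have l: "l (a \<otimes> b) = l a + l b" if "a \<in> carrier G" "b \<in> carrier G" for a b
    unfolding l_def by (rule lipschitz_harmonic_additive[OF nil mu(1,2) S(2) f(1) mean that])
  obtain \<Lambda> where \<Lambda>: "real_linear_on (real_abelianization G) \<Lambda>"
    "\<forall>x\<in>carrier G. \<Lambda> (ab_image G x) = l x"
    "\<forall>v\<in>carrier (real_abelianization G). \<Lambda> v \<in> span (l ` carrier G)"
    by (rule additive_real_abelianization_lift[where l = l, OF l])
  have SG: "S \<subseteq> carrier G"
    using S(2) by (simp add: symmetric_generating_set_def)
  \<comment> \<open>Finiteness of \<open>S\<close> gives \<Lambda> finite rank, hence
    boundedness.\<close>
  have "l x \<in> span (l ` S)" if "x \<in> carrier G" for x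
  proof -
    have "l x = (\<Sum>s\<in>S. real (count_list (reduced_word S x) s) *\<^sub>R l s)"
      using additive_foldr_mult[where l = l, OF l S(1) SG reduced_word(2)[OF S(2) that]] reduced_word(3)[OF S(2) that]
      by simp
    also have "\<dots> \<in> span (l ` S)"
      by (intro span_sum span_scale span_base imageI)
    finally show ?thesis .
  qed
  then have "span (l ` carrier G) \<subseteq> span (l ` S)"
    by (intro span_minimal) auto
  then have bounded: "bounded_real_linear_on (real_abelianization G) \<Lambda>"
    using \<Lambda>(3) S(1) by (intro finite_rank_bounded_real_linear_on[OF \<Lambda>(1), of "l ` S"]) auto
  \<comment> \<open>The series of \<open>pmf \<mu> x *\<^sub>R l x\<close> is summed in two ways:
    linearity gives \<Lambda> at the drift, and harmonicity of \<open>f\<close> at the identity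
    gives \<open>f \<one> - f \<one> = 0\<close>.\<close>
  have "((\<lambda>x. pmf \<mu> x *\<^sub>R \<Lambda> (ab_image G x)) has_sum \<Lambda> (ab_drift G \<mu>)) (carrier G)"
    unfolding ab_drift_eq_drift_vector[OF S mu(3)] by (rule drift_vector_has_sum[OF \<Lambda>(1) S mu(3)])
  then have 1: "((\<lambda>x. pmf \<mu> x *\<^sub>R l x) has_sum \<Lambda> (ab_drift G \<mu>)) (carrier G)"
    by (rule has_sum_cong[THEN iffD1, rotated]) (simp add: \<Lambda>(2))
  have "((\<lambda>x. pmf \<mu> x *\<^sub>R f (\<one> \<otimes> x)) has_sum f \<one>) (carrier G)"
    using mean unfolding mean_value_def by blast
  moreover have "((\<lambda>x. pmf \<mu> x *\<^sub>R f \<one>) has_sum 1 *\<^sub>R f \<one>) (carrier G)"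
    by (rule has_sum_bounded_linear[OF bounded_linear_scaleR_left pmf_has_sum_1[OF mu(1)]])
  ultimately have "((\<lambda>x. pmf \<mu> x *\<^sub>R f (\<one> \<otimes> x) + - 1 *\<^sub>R (pmf \<mu> x *\<^sub>R f \<one>)) has_sum
      f \<one> + - 1 *\<^sub>R (1 *\<^sub>R f \<one>)) (carrier G)"
    by (intro has_sum_add has_sum_scaleR)
  then have "((\<lambda>x. pmf \<mu> x *\<^sub>R f (\<one> \<otimes> x) + - 1 *\<^sub>R (pmf \<mu> x *\<^sub>R f \<one>)) has_sum 0) (carrier G)"
    by simp
  then have "((\<lambda>x. pmf \<mu> x *\<^sub>R l x) has_sum 0) (carrier G)"
    by (rule has_sum_cong[THEN iffD1, rotated]) (simp add: l_def scaleR_diff_right)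
  with 1 have "\<Lambda> (ab_drift G \<mu>) = 0"
    by (rule has_sum_unique)
  moreover have "\<forall>x\<in>carrier G. f x = f \<one> + \<Lambda> (ab_image G x)"
    using \<Lambda>(2) by (simp add: l_def)
  ultimately show ?thesis
    by (rule that[OF bounded])
qed

end

theorem theorem4p2:
  fixes G :: "('g, 'b) monoid_scheme" and S :: "'g set" and \<mu> :: "'g pmf"
  assumes "nilpotent_group G"
    and "finite S" and "symmetric_generating_set G S"
    and "set_pmf \<mu> \<subseteq> carrier G"
    and "adapted G \<mu>" and "smooth_measure G S \<mu>"
  shows
    "(ab_drift G \<mu> = \<zero>\<^bsub>real_abelianization G\<^esub> \<longrightarrow>
       (\<forall>f :: 'g \<Rightarrow> 'e::complex_banach. lipschitz_map G S f \<and> harmonic_map G \<mu> f \<longrightarrow>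
         (\<exists>c \<Lambda>. bounded_real_linear_on (real_abelianization G) \<Lambda> \<and>
            (\<forall>x\<in>carrier G. f x = c + \<Lambda> (ab_image G x))))) \<and>
     (ab_drift G \<mu> \<noteq> \<zero>\<^bsub>real_abelianization G\<^esub> \<longrightarrow>
       (\<forall>f :: 'g \<Rightarrow> 'e::complex_banach. lipschitz_map G S f \<and> harmonic_map G \<mu> f \<longrightarrow>
         (\<exists>c \<Lambda>. bounded_real_linear_on (real_abelianization G) \<Lambda> \<and>
            \<Lambda> (ab_drift G \<mu>) = 0 \<and>
            (\<forall>x\<in>carrier G. f x = c + \<Lambda> (ab_image G x)))))"
proof -
  interpret group G
    using assms(1) unfolding nilpotent_group_def by (rule conjunct1)
  obtain k where k: "lower_central_series G k = {\<one>\<^bsub>G\<^esub>}"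
    using assms(1) unfolding nilpotent_group_def by blast
  \<comment> \<open>This is the second case verbatim; the first follows by dropping the condition at
    the drift.\<close>
  have affine: "\<exists>c \<Lambda>. bounded_real_linear_on (real_abelianization G) \<Lambda> \<and> \<Lambda> (ab_drift G \<mu>) = 0 \<and>
      (\<forall>x\<in>carrier G. f x = c + \<Lambda> (ab_image G x))"
    if f: "lipschitz_map G S f \<and> harmonic_map G \<mu> f" for f :: "'g \<Rightarrow> 'e"
  proof -
    obtain \<Lambda> where "bounded_real_linear_on (real_abelianization G) \<Lambda>" "\<Lambda> (ab_drift G \<mu>) = 0"
      "\<forall>x\<in>carrier G. f x = f \<one>\<^bsub>G\<^esub> + \<Lambda> (ab_image G x)"
      by (rule lipschitz_harmonic_affine[OF k assms(2-6) conjunct1[OF f] conjunct2[OF f]])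
    then show ?thesis
      by blast
  qed
  show ?thesis
  proof (intro conjI impI allI)
    fix f :: "'g \<Rightarrow> 'e"
    assume "lipschitz_map G S f \<and> harmonic_map G \<mu> f"
    from affine[OF this] show "\<exists>c \<Lambda>. bounded_real_linear_on (real_abelianization G) \<Lambda> \<and>
        (\<forall>x\<in>carrier G. f x = c + \<Lambda> (ab_image G x))"
      by (elim exE conjE) (intro exI conjI)
  qed (rule affine)
qed

end
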